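(* Let $\mu$ be a partition of $w\geqslant 1$. Then \[ A_\mu(z,q)=\mathsf{PT}^q\Big((q-q^{-1})\,\mathrm{QEhr}_\mu(z,q)\Big), \] where $A_\mu$, $\mathrm{QEhr}_\mu$ and $\mathsf{PT}^q$ are as defined in the context.
   Context: For $n\geqslant 0$ let $[n]_q=\frac{q^n-q^{-n}}{q-q^{-1}}$. For a partition $\mu$ and an integer $h\geqslant 0$ write $s_\mu[s_h](q^{-1},q):=s_\mu(q^{-h},q^{-h+2},\ldots,q^{h})$, the Schur polynomial $s_\mu$ evaluated at the $h+1$ values $q^{-h+2j}$, $0\le j\le h$. This Laurent polynomial is invariant under $q\mapsto q^{-1}$ and can be written uniquely as $\sum_{k\geqslant 1} a_{\mu[h]}^{[k]}[k]_q$ with integers $a_{\mu[h]}^{[k]}$ (the $\mathrm{SL}_2$-plethysm coefficients); set $a_{\mu[h]}^{[0]}=0$. Define $A_\mu(z,q)=\sum_{k\geqslant 1,\,h\geqslant 0} a_{\mu[h]}^{[k]}q^kz^h$. Geometric objects: let $u=(1,\ldots,1)\in\mathbb{R}^w$. For $v\in\mathbb{R}^w$, apply Schensted row insertion (an inserted value bumps the leftmost entry of the row that is strictly greater than it) to $v_1,v_2,\ldots,v_w$ in this order; this yields an insertion tableau and a recording tableau, the latter a standard Young tableau with $w$ cells. For a standard Young tableau $Q$ of shape $\mu$, let $\mathcal{C}(Q)=\{v\in[0,1]^w : \text{the recording tableau of } v \text{ is } Q\}$. For $P\subseteq[0,1]^w$ and an integer $h\ge0$ let $hP=\{hv: v\in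 P\}$, and define the quantum Ehrhart series \[ \mathrm{QEhr}_P(z,q)=\sum_{h\geqslant 0}\Big(\sum_{v\in hP\cap\mathbb{Z}^w} q^{2\langle u,v\rangle-wh}\Big)z^h . \] The series $\mathrm{QEhr}_{\mathcal{C}(Q)}(z,q)$ does not depend on the choice of $Q$ among standard Young tableaux of shape $\mu$; denote it $\mathrm{QEhr}_\mu(z,q)$. The positive term operator $\mathsf{PT}^q$ acts on series $\sum_{h\ge0}\sum_{k\in\mathbb{Z}}c_{h,k}q^kz^h$ (with finitely many $k$ for each $h$) by $\mathsf{PT}^q\sum_{h,k}c_{h,k}q^kz^h=\sum_{h\geqslant0}\sum_{k\geqslant 0}c_{h,k}q^kz^h$.
   Formalization: For h=0 the dilate 0P is taken to contain the origin only if P does (rather than 0P={0} for all nonempty P), since with the literal convention the z^0 terms disagree whenever μ has at least two rows, e.g. μ=(1,1). *)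

theory Defs
  imports Complex_Main "HOL-Computational_Algebra.Formal_Laurent_Series"
begin

section \<open>Partitions and tableaux\<close>

text \<open>
  A tableau is the list of its rows, read from the longest row on; for a list of rows \<open>T\<close>,
  \<open>map length T\<close> is its shape.
\<close>

definition partition_of :: "nat list \<Rightarrow> nat \<Rightarrow> bool" where
  "partition_of \<mu> w \<longleftrightarrow> sorted_wrt (\<ge>) \<mu> \<and> (\<forall>p\<in>set \<mu>. p > 0) \<and> sum_list \<mu> = w"

definition semistandard_tableau :: "nat list \<Rightarrow> nat list list \<Rightarrow> bool" where
  "semistandard_tableau \<mu> T \<longleftrightarrow>
     map length T = \<mu> \<and>
     (\<forall>r\<in>set T. sorted r) \<and>
     (\<forall>i j. Suc i < length T \<and> j < length (T ! Suc i) \<longrightarrow> T ! i ! j < T ! Suc i ! j)"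

definition standard_tableau :: "nat list \<Rightarrow> nat list list \<Rightarrow> bool" where
  "standard_tableau \<mu> Q \<longleftrightarrow>
     semistandard_tableau \<mu> Q \<and> distinct (concat Q) \<and> set (concat Q) = {1..sum_list \<mu>}"

text \<open>
  The Schur polynomial in \<open>length xs\<close> variables, evaluated at \<open>xs\<close>: the sum of the monomials of
  all semistandard tableaux of shape \<open>\<mu>\<close>, the entry \<open>i\<close> standing for the variable \<open>xs ! i\<close>.
\<close>

definition schur :: "nat list \<Rightarrow> 'a::comm_semiring_1 list \<Rightarrow> 'a" where
  "schur \<mu> xs =
     (\<Sum>T | semistandard_tableau \<mu> T \<and> set (concat T) \<subseteq> {..<length xs}.
        prod_list (map (\<lambda>i. xs ! i) (concat T)))"


section \<open>The plethysm coefficients\<close>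

text \<open>
  Laurent polynomials in \<open>q\<close> live in the field \<open>rat fls\<close>, and series in \<open>z\<close> with such
  coefficients in \<open>rat fls fps\<close>.
\<close>

abbreviation q :: "rat fls" where
  "q \<equiv> fls_X"

definition q_int :: "nat \<Rightarrow> rat fls" where
  "q_int n = (q powi int n - q powi (- int n)) / (q - q powi (-1))"

definition schur_plethysm :: "nat list \<Rightarrow> nat \<Rightarrow> rat fls" where
  "schur_plethysm \<mu> h = schur \<mu> (map (\<lambda>j. q powi (2 * int j - int h)) [0..<Suc h])"

definition plethysm_coeff :: "nat list \<Rightarrow> nat \<Rightarrow> nat \<Rightarrow> int" where
  "plethysm_coeff \<mu> h =
     (THE a. finite {k. a k \<noteq> 0} \<and> a 0 = 0 \<and>
             schur_plethysm \<mu> h = (\<Sum>k | a k \<noteq> 0. of_int (a k) * q_int k))"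

definition plethysm_series :: "nat list \<Rightarrow> rat fls fps" where
  "plethysm_series \<mu> =
     Abs_fps (\<lambda>h. \<Sum>k | k \<ge> 1 \<and> plethysm_coeff \<mu> h k \<noteq> 0.
                    of_int (plethysm_coeff \<mu> h k) * q powi int k)"


section \<open>Schensted insertion\<close>

text \<open>The second component is the bumped entry, if any.\<close>

fun row_insert :: "'a::linorder \<Rightarrow> 'a list \<Rightarrow> 'a list \<times> 'a option" where
  "row_insert x [] = ([x], None)"
| "row_insert x (y # ys) =
     (if x < y then (x # ys, Some y)
      else (let (zs, b) = row_insert x ys in (y # zs, b)))"

text \<open>The second component is the index of the row in which the new cell is created.\<close>

fun schensted_insert :: "'a::linorder \<Rightarrow> 'a list list \<Rightarrow> 'a list list \<times> nat" where
  "schensted_insert x [] = ([[x]], 0)"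
| "schensted_insert x (r # rs) =
     (case row_insert x r of
        (r', None) \<Rightarrow> (r' # rs, 0)
      | (r', Some y) \<Rightarrow> (let (rs', i) = schensted_insert y rs in (r' # rs', Suc i)))"

definition add_cell :: "nat \<Rightarrow> nat \<Rightarrow> nat list list \<Rightarrow> nat list list" where
  "add_cell k i Q = (if i < length Q then Q[i := Q ! i @ [k]] else Q @ [[k]])"

definition schensted :: "'a::linorder list \<Rightarrow> 'a list list \<times> nat list list" where
  "schensted xs =
     foldl (\<lambda>(P, Q) (k, x). let (P', i) = schensted_insert x P in (P', add_cell k i Q))
       ([], []) (List.enumerate 1 xs)"

definition recording_tableau :: "'a::linorder list \<Rightarrow> nat list list" where
  "recording_tableau xs = snd (schensted xs)"


section \<open>Quantum Ehrhart series\<close>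

text \<open>Points of \<open>\<real>\<^sup>w\<close> are lists of length \<open>w\<close>.\<close>

definition chamber :: "nat list list \<Rightarrow> real list set" where
  "chamber Q = {v. length v = length (concat Q) \<and> set v \<subseteq> {0..1} \<and> recording_tableau v = Q}"

text \<open>
  For \<open>h > 0\<close> this is \<open>{hv | v \<in> P}\<close>. For \<open>h = 0\<close> that set would be \<open>{0}\<close> for every nonempty
  \<open>P\<close>, also if the origin has been removed from \<open>P\<close>; as usual for half-open polytopes, the zeroth
  dilate contains the origin only if \<open>P\<close> does. Thus \<open>dilate h (chamber Q)\<close> is, for all \<open>h\<close>, the
  set of points of \<open>[0,h]\<^sup>w\<close> with recording tableau \<open>Q\<close>. With \<open>{0}\<close> instead, the coefficient of
  \<open>z\<^sup>0\<close> in the series of \<open>chamber Q\<close> would be 1 for every \<open>Q\<close>, whereas the Schur polynomial of a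
  partition with at least two rows vanishes in a single variable.
\<close>

definition dilate :: "nat \<Rightarrow> real list set \<Rightarrow> real list set" where
  "dilate h P = (if h = 0 then {v \<in> P. set v \<subseteq> {0}} else map (\<lambda>x. real h * x) ` P)"

text \<open>
  Here \<open>w\<close> is the dimension of the ambient space, and \<open>sum_list v\<close> is the inner product of \<open>v\<close>
  with \<open>(1,\<dots>,1)\<close>.
\<close>

definition quantum_ehrhart :: "nat \<Rightarrow> real list set \<Rightarrow> rat fls fps" where
  "quantum_ehrhart w P =
     Abs_fps (\<lambda>h. \<Sum>v | map real_of_int v \<in> dilate h P.
                    q powi (2 * sum_list v - int w * int h))"

definition positive_terms :: "rat fls fps \<Rightarrow> rat fls fps" where
  "positive_terms F = Abs_fps (\<lambda>h. fps_to_fls (fls_regpart (fps_nth F h)))"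

end

theory Submission
  imports Defs
begin

text \<open>
  Schensted's correspondence is a bijection between the words of length \<open>w\<close> over \<open>{0..h}\<close> with
  recording tableau \<open>Q\<close> and the semistandard tableaux of shape \<open>\<mu>\<close> over the same alphabet, and it
  preserves the content. Hence the coefficient of \<open>z\<^sup>h\<close> in the quantum Ehrhart series is the Schur
  polynomial \<open>S\<close> at \<open>q\<^sup>-\<^sup>h, \<dots>, q\<^sup>h\<close>. Schur polynomials being symmetric, \<open>S\<close> is invariant under
  inverting \<open>q\<close>, so \<open>(q - q\<^sup>-\<^sup>1) S\<close> is antisymmetric, and its coefficients at positive powers of
  \<open>q\<close> are the coefficients of \<open>S\<close> in the quantum integers.
  The symmetry of Schur polynomials is the Bender-Knuth involution in terms of interlacing shapes:
  the shapes \<open>\<nu>\<close> between \<open>\<kappa>\<close> and \<open>\<mu>\<close> form a box, whose central reflection exchanges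
  \<open>|\<mu>| - |\<nu>|\<close> and \<open>|\<nu>| - |\<kappa>|\<close>.
\<close>

unbundle fps_syntax

section \<open>Symmetry of Schur polynomials\<close>

text \<open>
  Shapes of a fixed length, possibly ending in zeros: removing the largest letter from a tableau
  then never changes the number of rows.
\<close>

definition interlacing :: "nat list \<Rightarrow> nat list \<Rightarrow> bool" where
  "interlacing \<nu> \<mu> \<longleftrightarrow> length \<nu> = length \<mu> \<and> (\<forall>i<length \<mu>. \<nu> ! i \<le> \<mu> ! i) \<and>
     (\<forall>i. Suc i < length \<mu> \<longrightarrow> \<mu> ! Suc i \<le> \<nu> ! i)"

section \<open>Tableaux with bounded entries and the branching rule for Schur polynomials\<close>

definition bounded_tableaux :: "nat list \<Rightarrow> nat \<Rightarrow> nat list list set" where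
  "bounded_tableaux \<mu> n = {T. semistandard_tableau \<mu> T \<and> set (concat T) \<subseteq> {..<n}}"

lemma schur_eq_sum:
  "schur \<mu> xs = (\<Sum>T\<in>bounded_tableaux \<mu> (length xs). prod_list (map ((!) xs) (concat T)))"
  by (simp add: schur_def bounded_tableaux_def)

lemma length_concat_semistandard:
  "semistandard_tableau \<mu> T \<Longrightarrow> length (concat T) = sum_list \<mu>"
  by (auto simp: semistandard_tableau_def length_concat)

lemma finite_bounded_tableaux: "finite (bounded_tableaux \<mu> n)"
proof -
  let ?R = "{r. set r \<subseteq> {..<n} \<and> length r \<le> sum_list \<mu>}"
  have "bounded_tableaux \<mu> n \<subseteq> {T. set T \<subseteq> ?R \<and> length T = length \<mu>}"
  proof
    fix T assume "T \<in> bounded_tableaux \<mu> n"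
    then have T: "map length T = \<mu>" "\<forall>r\<in>set T. set r \<subseteq> {..<n}"
      by (auto simp: bounded_tableaux_def semistandard_tableau_def)
    have "length r \<le> sum_list \<mu>" if "r \<in> set T" for r
      using T(1) that member_le_sum_list[of "length r" \<mu>] by auto
    then show "T \<in> {T. set T \<subseteq> ?R \<and> length T = length \<mu>}"
      using T(2) map_eq_imp_length_eq[of length T id \<mu>] T(1) by auto
  qed
  moreover have "finite {T. set T \<subseteq> ?R \<and> length T = length \<mu>}"
    by (intro finite_lists_length_eq finite_lists_length_le) simp
  ultimately show ?thesis by (rule finite_subset)
qed

lemma finite_interlacing: "finite {\<nu>. interlacing \<nu> \<mu>}"
proof (rule finite_subset)
  show "{\<nu>. interlacing \<nu> \<mu>} \<subseteq> {\<nu>. set \<nu> \<subseteq> {..Max (set \<mu>)} \<and> length \<nu> = length \<mu>}"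
    by (auto simp: interlacing_def in_set_conv_nth) (meson List.finite_set Max_ge le_trans nth_mem)
qed (simp add: finite_lists_length_eq)

lemma interlacing_sum_le: "interlacing \<nu> \<mu> \<Longrightarrow> sum_list \<nu> \<le> sum_list \<mu>"
  by (auto simp: interlacing_def sum_list_sum_nth intro!: sum_mono)

text \<open>The entry \<open>\<mu> ! Suc i\<close> separates \<open>\<nu> ! Suc i\<close> from
  \<open>\<nu> ! i\<close>. This supplies the hypothesis of the branching rule when it is applied to
  \<open>\<nu>\<close> in turn.\<close>

lemma interlacing_decreasing:
  assumes "interlacing \<nu> \<mu>"
  shows "sorted_wrt (\<ge>) \<nu>"
proof -
  have "\<nu> ! Suc i \<le> \<nu> ! i" if "Suc i < length \<nu>" for i
    using assms that unfolding interlacing_def by (metis le_trans)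
  then show ?thesis
    by (subst sorted_wrt_iff_nth_Suc_transp) (auto simp: transp_def)
qed

lemma decreasing_nth_Suc: "sorted_wrt (\<ge>) (\<mu>::nat list) \<Longrightarrow> Suc i < length \<mu> \<Longrightarrow> \<mu> ! Suc i \<le> \<mu> ! i"
  by (simp add: sorted_wrt_iff_nth_less)

text \<open>All copies of the largest letter stand at the end of a sorted row, so the smaller
  entries and the length determine the row.\<close>

lemma sorted_filter_less_append:
  fixes r :: "nat list"
  assumes "sorted r" and "set r \<subseteq> {..<Suc n}"
  shows "filter (\<lambda>t. t < n) r @ replicate (length r - length (filter (\<lambda>t. t < n) r)) n = r"
  using assms
proof (induction r)
  case (Cons a r)
  show ?case
  proof (cases "a < n")
    case False
    then have "set (a # r) \<subseteq> {n}" using Cons.prems by fastforce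
    then have "filter (\<lambda>t. t < n) (a # r) = []" "a # r = replicate (length (a # r)) n"
      by (auto simp: filter_empty_conv intro!: replicate_eqI)
    then show ?thesis by (metis append_Nil diff_zero list.size(3))
  qed (use Cons in auto)
qed simp

text \<open>The cells holding the largest letter \<open>n\<close> form a horizontal strip: two of
  them in one column would violate column strictness, and this is the second family of interlacing
  inequalities.\<close>

lemma restrict_tableau:
  assumes \<mu>: "sorted_wrt (\<ge>) \<mu>" and T: "T \<in> bounded_tableaux \<mu> (Suc n)"
  defines "T' \<equiv> map (filter (\<lambda>t. t < n)) T"
  shows "interlacing (map length T') \<mu>" and "T' \<in> bounded_tableaux (map length T') n"
    and "map2 (\<lambda>l r. r @ replicate (l - length r) n) \<mu> T' = T"
proof -
  have sh: "map length T = \<mu>" and so: "\<And>i. i < length T \<Longrightarrow> sorted (T ! i)"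
    and col: "\<And>i j. Suc i < length T \<Longrightarrow> j < length (T ! Suc i) \<Longrightarrow> T ! i ! j < T ! Suc i ! j"
    and bd: "\<And>i. i < length T \<Longrightarrow> set (T ! i) \<subseteq> {..<Suc n}"
    using T by (auto simp: bounded_tableaux_def semistandard_tableau_def dest!: nth_mem)
  have len: "length T = length \<mu>" "\<And>i. i < length T \<Longrightarrow> length (T ! i) = \<mu> ! i"
    by (auto simp flip: sh)
  have app: "T ! i = T' ! i @ replicate (\<mu> ! i - length (T' ! i)) n" if "i < length T" for i
    using sorted_filter_less_append[OF so bd, OF that that] that by (simp add: T'_def len)
  have lt: "T' ! i ! j < n" if "i < length T" "j < length (T' ! i)" for i j
    using nth_mem[OF that(2)] that(1) by (auto simp: T'_def)
  have [simp]: "length T' = length T" by (simp add: T'_def)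
  have le: "length (T' ! i) \<le> \<mu> ! i" if "i < length T" for i
    using app[OF that] len(2)[OF that] by (metis length_append le_add1)
  have pre: "T ! i ! j = (if j < length (T' ! i) then T' ! i ! j else n)"
    if "i < length T" "j < \<mu> ! i" for i j
    using app[OF that(1)] that le[OF that(1)] by (auto simp: nth_append)
  \<comment> \<open>Otherwise column \<open>length (T' ! i)\<close> of row \<open>i\<close> holds
    \<open>n\<close> and still has a cell below it, whose entry would have to exceed
    \<open>n\<close>.\<close>
  have inter: "\<mu> ! Suc i \<le> length (T' ! i)" if "Suc i < length T" for i
  proof (rule ccontr)
    assume *: "\<not> \<mu> ! Suc i \<le> length (T' ! i)"
    then have "T ! i ! length (T' ! i) = n"
      using pre[of i "length (T' ! i)"] that decreasing_nth_Suc[OF \<mu>, of i] len by auto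
    moreover have "T ! i ! length (T' ! i) < T ! Suc i ! length (T' ! i)"
      using col[OF that] * len that by auto
    moreover have "T ! Suc i ! length (T' ! i) \<in> set (T ! Suc i)"
      using * len that by (auto intro!: nth_mem)
    ultimately show False using bd[OF that] by auto
  qed
  show "interlacing (map length T') \<mu>"
    using le inter by (auto simp: interlacing_def len)
  have "T' ! i ! j < T' ! Suc i ! j" if "Suc i < length T" "j < length (T' ! Suc i)" for i j
  proof -
    have j: "j < \<mu> ! Suc i" using le[OF that(1)] that(2) by simp
    then have "j < length (T' ! i)" using inter[OF that(1)] by simp
    moreover have "T ! i ! j < T ! Suc i ! j" using col j that len by simp
    ultimately show ?thesis
      using pre[OF that(1) j] pre[of i j] le[of i] that by auto
  qed
  moreover have "\<forall>r\<in>set T'. sorted r" using so by (auto simp: T'_def in_set_conv_nth sorted_filter[where f = id, simplified])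
  ultimately show "T' \<in> bounded_tableaux (map length T') n"
    by (auto simp: bounded_tableaux_def semistandard_tableau_def) (auto simp: T'_def)
  show "map2 (\<lambda>l r. r @ replicate (l - length r) n) \<mu> T' = T"
    by (rule nth_equalityI) (use app len in auto)
qed

text \<open>Inverse of the restriction: the cells of \<open>\<mu>\<close> outside
  \<open>\<nu>\<close> are filled with \<open>n\<close>. The multiset equation records that each new
  cell contributes one letter \<open>n\<close> to the weight.\<close>

lemma extend_tableau:
  assumes inter: "interlacing \<nu> \<mu>" and T': "T' \<in> bounded_tableaux \<nu> n"
  defines "T \<equiv> map2 (\<lambda>l r. r @ replicate (l - length r) n) \<mu> T'"
  shows "T \<in> bounded_tableaux \<mu> (Suc n)" and "map (filter (\<lambda>t. t < n)) T = T'"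
    and "mset (concat T) = mset (concat T') + replicate_mset (sum_list \<mu> - sum_list \<nu>) n"
proof -
  have sh: "map length T' = \<nu>" and so: "\<And>i. i < length T' \<Longrightarrow> sorted (T' ! i)"
    and col: "\<And>i j. Suc i < length T' \<Longrightarrow> j < length (T' ! Suc i) \<Longrightarrow> T' ! i ! j < T' ! Suc i ! j"
    and bd: "\<And>i. i < length T' \<Longrightarrow> set (T' ! i) \<subseteq> {..<n}"
    using T' by (auto simp: bounded_tableaux_def semistandard_tableau_def dest!: nth_mem)
  have len: "length T' = length \<mu>" "\<And>i. i < length \<mu> \<Longrightarrow> length (T' ! i) = \<nu> ! i"
    using inter by (auto simp: interlacing_def simp flip: sh)
  have le: "\<nu> ! i \<le> \<mu> ! i" if "i < length \<mu>" for i
    using inter that by (auto simp: interlacing_def)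
  have app: "T ! i = T' ! i @ replicate (\<mu> ! i - \<nu> ! i) n" if "i < length \<mu>" for i
    using that len by (simp add: T_def)
  have lenT [simp]: "length T = length \<mu>" by (simp add: T_def len)
  have "map length T = \<mu>"
    by (rule nth_equalityI) (use app le len in auto)
  moreover have "sorted (T ! i)" if "i < length \<mu>" for i
    using app[OF that] so[of i] bd[of i] that len by (auto simp: sorted_append less_imp_le subset_iff)
  then have "\<forall>r\<in>set T. sorted r" by (auto simp: in_set_conv_nth)
  moreover have "T ! i ! j < T ! Suc i ! j" if "Suc i < length T" "j < length (T ! Suc i)" for i j
  proof -
    have i: "Suc i < length \<mu>" "i < length \<mu>" using that by auto
    have "j < \<mu> ! Suc i" using that(2) app[OF i(1)] len(2)[OF i(1)] le[OF i(1)] by auto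
    \<comment> \<open>Interlacing puts the upper cell inside \<open>\<nu>\<close>, so its entry is
      below \<open>n\<close>; this settles the case where the lower cell is new.\<close>
    then have j: "j < \<nu> ! i" using inter i by (force simp: interlacing_def)
    then have 1: "T ! i ! j = T' ! i ! j" "T' ! i ! j < n"
      using app[OF i(2)] len(1) len(2)[OF i(2)] i subsetD[OF bd[of i] nth_mem[of j "T' ! i"]]
      by (auto simp: nth_append)
    show ?thesis
    proof (cases "j < \<nu> ! Suc i")
      case True
      then show ?thesis using 1 col[of i j] app[OF i(1)] len i by (auto simp: nth_append)
    next
      case False
      then show ?thesis using 1 app[OF i(1)] len(2)[OF i(1)] \<open>j < \<mu> ! Suc i\<close> by (auto simp: nth_append)
    qed
  qed
  moreover have "set (T ! i) \<subseteq> {..<Suc n}" if "i < length \<mu>" for i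
    using app[OF that] bd[of i] len that by (auto simp: less_Suc_eq)
  then have "set (concat T) \<subseteq> {..<Suc n}" by (force simp: in_set_conv_nth)
  ultimately show mem: "T \<in> bounded_tableaux \<mu> (Suc n)"
    by (auto simp: bounded_tableaux_def semistandard_tableau_def)
  have "filter (\<lambda>t. t < n) (T ! i) = T' ! i" if "i < length \<mu>" for i
    using app[OF that] bd[of i] len that by (auto simp: filter_id_conv subset_iff)
  then show "map (filter (\<lambda>t. t < n)) T = T'"
    by (intro nth_equalityI) (auto simp: len)
  then have fc: "filter (\<lambda>t. t < n) (concat T) = concat T'" by (simp add: filter_concat)
  have sc: "set (concat T) \<subseteq> {..<Suc n}" using mem by (simp add: bounded_tableaux_def)
  \<comment> \<open>The entries are split into those below \<open>n\<close> and the copies of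
    \<open>n\<close>; comparing lengths gives the number of copies.\<close>
  have "mset (concat T) = mset (filter (\<lambda>t. t < n) (concat T)) + mset (filter (\<lambda>t. \<not> t < n) (concat T))"
    by (metis mset_filter multiset_partition)
  moreover have "filter (\<lambda>t. \<not> t < n) (concat T) = replicate (length (filter (\<lambda>t. \<not> t < n) (concat T))) n"
    using sc by (intro replicate_eqI) (auto simp: less_Suc_eq)
  moreover have "length (concat T) = sum_list \<mu>" "length (concat T') = sum_list \<nu>"
    using mem T' by (auto simp: bounded_tableaux_def length_concat_semistandard)
  moreover have "length (concat T) = length (concat T') + length (filter (\<lambda>t. \<not> t < n) (concat T))"
    by (metis fc sum_length_filter_compl)
  ultimately show "mset (concat T) = mset (concat T') + replicate_mset (sum_list \<mu> - sum_list \<nu>) n"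
    by (metis add_diff_cancel_left' fc mset_replicate)
qed

text \<open>Tableaux are sorted by the shape \<open>\<nu>\<close> that their letters below
  \<open>length xs\<close> occupy; every remaining cell carries the last variable
  \<open>x\<close>.\<close>

lemma schur_snoc:
  fixes xs :: "'a::comm_semiring_1 list"
  assumes "sorted_wrt (\<ge>) \<mu>"
  shows "schur \<mu> (xs @ [x]) =
    (\<Sum>\<nu> | interlacing \<nu> \<mu>. x ^ (sum_list \<mu> - sum_list \<nu>) * schur \<nu> xs)"
proof -
  define n where "n = length xs"
  have "(\<Sum>\<nu> | interlacing \<nu> \<mu>. x ^ (sum_list \<mu> - sum_list \<nu>) * schur \<nu> xs) =
    (\<Sum>(\<nu>, T)\<in>(SIGMA \<nu>:{\<nu>. interlacing \<nu> \<mu>}. bounded_tableaux \<nu> n).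
       x ^ (sum_list \<mu> - sum_list \<nu>) * prod_list (map ((!) xs) (concat T)))"
    by (simp add: schur_eq_sum n_def sum_distrib_left sum.Sigma finite_interlacing finite_bounded_tableaux)
  also have "\<dots> = (\<Sum>T\<in>bounded_tableaux \<mu> (Suc n). prod_list (map ((!) (xs @ [x])) (concat T)))"
  proof (rule sum.reindex_bij_witness[where
        j = "\<lambda>(\<nu>, T). map2 (\<lambda>l r. r @ replicate (l - length r) n) \<mu> T" and
        i = "\<lambda>T. (map length (map (filter (\<lambda>t. t < n)) T), map (filter (\<lambda>t. t < n)) T)"], goal_cases)
    case (1 a)
    then show ?case
      using extend_tableau(2)[of "fst a" \<mu> "snd a" n]
      by (auto simp: bounded_tableaux_def semistandard_tableau_def simp del: map_map)
  next
    case (2 a)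
    then show ?case using extend_tableau(1)[of "fst a" \<mu> "snd a" n] by auto
  next
    case (3 b)
    then show ?case using restrict_tableau(3)[OF assms, of b n] by auto
  next
    case (4 b)
    then show ?case using restrict_tableau(1,2)[OF assms, of b n] by auto
  next
    case (5 a)
    obtain \<nu> T' where a: "a = (\<nu>, T')" by (cases a)
    with 5 have T': "interlacing \<nu> \<mu>" "T' \<in> bounded_tableaux \<nu> n" by auto
    have "map ((!) (xs @ [x])) (concat T') = map ((!) xs) (concat T')"
      using T'(2) by (auto simp: bounded_tableaux_def nth_append n_def)
    \<comment> \<open>The letters \<open>n\<close> are scattered over the rows of the extended
      tableau, so the products are compared over multisets rather than lists.\<close>
    then have "image_mset ((!) (xs @ [x])) (mset (concat T')) = image_mset ((!) xs) (mset (concat T'))"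
      by (metis mset_map)
    then show ?case
      unfolding a case_prod_conv prod_mset_prod_list[symmetric] mset_map extend_tableau(3)[OF T']
      by (simp add: n_def mult.commute)
  qed
  finally show ?thesis by (simp add: schur_eq_sum n_def)
qed

section \<open>Invariance under exchanging and reversing variables\<close>

lemma sum_power_between_interlacing_commute:
  fixes x y :: "'a::comm_semiring_1"
  shows "(\<Sum>\<nu> | interlacing \<kappa> \<nu> \<and> interlacing \<nu> \<mu>.
      y ^ (sum_list \<mu> - sum_list \<nu>) * x ^ (sum_list \<nu> - sum_list \<kappa>)) =
    (\<Sum>\<nu> | interlacing \<kappa> \<nu> \<and> interlacing \<nu> \<mu>.
      x ^ (sum_list \<mu> - sum_list \<nu>) * y ^ (sum_list \<nu> - sum_list \<kappa>))"
proof (cases "length \<kappa> = length \<mu>")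
  case False
  then have none: "{\<nu>. interlacing \<kappa> \<nu> \<and> interlacing \<nu> \<mu>} = {}" by (auto simp: interlacing_def)
  show ?thesis unfolding none by simp
next
  case len: True
  \<comment> \<open>The constraints on \<open>\<nu>\<close> decouple into one interval per row: from
    below by \<open>\<kappa> ! i\<close> and \<open>\<mu> ! Suc i\<close>, from above by
    \<open>\<mu> ! i\<close> and \<open>\<kappa> ! (i - 1)\<close>. The defaults \<open>0\<close>
    and \<open>\<mu> ! 0\<close> make a missing neighbour impose nothing.\<close>
  define lo where "lo i = max (\<kappa> ! i) (if Suc i < length \<mu> then \<mu> ! Suc i else 0)" for i
  define hi where "hi i = min (\<mu> ! i) (if i = 0 then \<mu> ! 0 else \<kappa> ! (i - 1))" for i
  define refl where "refl \<nu> = map (\<lambda>i. lo i + hi i - \<nu> ! i) [0..<length \<mu>]" for \<nu> :: "nat list"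
  have iff: "interlacing \<kappa> \<nu> \<and> interlacing \<nu> \<mu> \<longleftrightarrow>
    length \<nu> = length \<mu> \<and> (\<forall>i<length \<mu>. lo i \<le> \<nu> ! i \<and> \<nu> ! i \<le> hi i)" for \<nu>
  proof
    assume L: "interlacing \<kappa> \<nu> \<and> interlacing \<nu> \<mu>"
    have "lo i \<le> \<nu> ! i \<and> \<nu> ! i \<le> hi i" if "i < length \<mu>" for i
      using L that by (cases i) (simp_all add: interlacing_def lo_def hi_def)
    then show "length \<nu> = length \<mu> \<and> (\<forall>i<length \<mu>. lo i \<le> \<nu> ! i \<and> \<nu> ! i \<le> hi i)"
      using L by (simp add: interlacing_def)
  next
    assume R: "length \<nu> = length \<mu> \<and> (\<forall>i<length \<mu>. lo i \<le> \<nu> ! i \<and> \<nu> ! i \<le> hi i)"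
    have "\<kappa> ! i \<le> \<nu> ! i" "\<nu> ! i \<le> \<mu> ! i" if "i < length \<mu>" for i
      using conjunct2[OF R, rule_format, OF that] by (simp_all add: lo_def hi_def)
    moreover have "\<mu> ! Suc i \<le> \<nu> ! i" "\<nu> ! Suc i \<le> \<kappa> ! i" if "Suc i < length \<mu>" for i
      using conjunct2[OF R, rule_format, of i] conjunct2[OF R, rule_format, of "Suc i"] that
      by (simp_all add: lo_def hi_def)
    ultimately show "interlacing \<kappa> \<nu> \<and> interlacing \<nu> \<mu>"
      using R len by (simp add: interlacing_def)
  qed
  \<comment> \<open>The maximum in \<open>lo i\<close> and the minimum in \<open>hi (Suc i)\<close>
    are of the same pair and add up to its sum; the unpaired ends are \<open>\<mu> ! 0\<close> and
    the last part of \<open>\<kappa>\<close>. Reflection therefore sends \<open>|\<nu>|\<close> to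
    \<open>|\<mu>| + |\<kappa>| - |\<nu>|\<close>.\<close>
  have lohi: "(\<Sum>i<length \<mu>. lo i + hi i) = sum_list \<mu> + sum_list \<kappa>"
  proof (cases "length \<mu>")
    case 0
    then show ?thesis using len by simp
  next
    case (Suc m)
    have "(\<Sum>i<Suc m. lo i) = (\<Sum>i<m. max (\<kappa> ! i) (\<mu> ! Suc i)) + \<kappa> ! m"
      using Suc by (simp add: lo_def)
    moreover have "(\<Sum>i<Suc m. hi i) = \<mu> ! 0 + (\<Sum>i<m. min (\<mu> ! Suc i) (\<kappa> ! i))"
      by (simp add: sum.lessThan_Suc_shift hi_def del: sum.lessThan_Suc)
    moreover have "(\<Sum>i<m. max (\<kappa> ! i) (\<mu> ! Suc i)) + (\<Sum>i<m. min (\<mu> ! Suc i) (\<kappa> ! i)) =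
      (\<Sum>i<m. \<kappa> ! i) + (\<Sum>i<m. \<mu> ! Suc i)"
      unfolding sum.distrib[symmetric] by (intro sum.cong) auto
    moreover have "sum_list \<mu> = \<mu> ! 0 + (\<Sum>i<m. \<mu> ! Suc i)"
      by (simp only: sum_list_sum_nth Suc atLeast0LessThan sum.lessThan_Suc_shift)
    moreover have "sum_list \<kappa> = (\<Sum>i<m. \<kappa> ! i) + \<kappa> ! m"
      by (simp add: sum_list_sum_nth Suc len atLeast0LessThan)
    ultimately show ?thesis by (simp add: Suc sum.distrib)
  qed
  have inv: "refl (refl \<nu>) = \<nu>" and mem: "interlacing \<kappa> (refl \<nu>) \<and> interlacing (refl \<nu>) \<mu>"
    and sum: "sum_list (refl \<nu>) = sum_list \<mu> + sum_list \<kappa> - sum_list \<nu>"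
    if "interlacing \<kappa> \<nu> \<and> interlacing \<nu> \<mu>" for \<nu>
  proof -
    have \<nu>: "length \<nu> = length \<mu>" "\<And>i. i < length \<mu> \<Longrightarrow> lo i \<le> \<nu> ! i \<and> \<nu> ! i \<le> hi i"
      using that iff by auto
    show "refl (refl \<nu>) = \<nu>"
    proof (rule nth_equalityI)
      fix i assume "i < length (refl (refl \<nu>))"
      then show "refl (refl \<nu>) ! i = \<nu> ! i" using \<nu>(2)[of i] by (simp add: refl_def)
    qed (simp add: refl_def \<nu>)
    have "lo i \<le> lo i + hi i - \<nu> ! i \<and> lo i + hi i - \<nu> ! i \<le> hi i" if "i < length \<mu>" for i
      using \<nu>(2)[OF that] by linarith
    then show "interlacing \<kappa> (refl \<nu>) \<and> interlacing (refl \<nu>) \<mu>"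
      unfolding iff by (auto simp: refl_def)
    have "sum_list (refl \<nu>) = (\<Sum>i<length \<mu>. lo i + hi i - \<nu> ! i)"
      by (simp add: refl_def sum_list_sum_nth atLeast0LessThan)
    also have "\<dots> = (\<Sum>i<length \<mu>. lo i + hi i) - (\<Sum>i<length \<mu>. \<nu> ! i)"
      by (rule sum_subtractf_nat) (use \<nu>(2) in \<open>auto intro: trans_le_add2\<close>)
    also have "\<dots> = sum_list \<mu> + sum_list \<kappa> - sum_list \<nu>"
      unfolding lohi using \<nu>(1) by (simp add: sum_list_sum_nth atLeast0LessThan)
    finally show "sum_list (refl \<nu>) = sum_list \<mu> + sum_list \<kappa> - sum_list \<nu>" .
  qed
  show ?thesis
  proof (rule sum.reindex_bij_witness[where i = refl and j = refl], goal_cases)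
    case (5 \<nu>)
    then show ?case
      using sum[of \<nu>] interlacing_sum_le[of \<kappa> \<nu>] interlacing_sum_le[of \<nu> \<mu>]
      by (simp add: mult.commute)
  qed (use inv mem in auto)
qed

text \<open>Branching twice and interchanging the two summations makes the coefficient of
  \<open>schur \<kappa> xs\<close> a sum that is symmetric in \<open>x\<close> and
  \<open>y\<close>.\<close>

lemma schur_snoc2_commute:
  fixes xs :: "'a::comm_semiring_1 list"
  assumes "sorted_wrt (\<ge>) \<mu>"
  shows "schur \<mu> (xs @ [x, y]) = schur \<mu> (xs @ [y, x])"
proof -
  let ?K = "{\<kappa>. \<exists>\<nu>. interlacing \<kappa> \<nu> \<and> interlacing \<nu> \<mu>}"
  have "finite (\<Union>\<nu>\<in>{\<nu>. interlacing \<nu> \<mu>}. {\<kappa>. interlacing \<kappa> \<nu>})"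
    by (simp add: finite_interlacing)
  moreover have "?K = (\<Union>\<nu>\<in>{\<nu>. interlacing \<nu> \<mu>}. {\<kappa>. interlacing \<kappa> \<nu>})" by auto
  ultimately have fin: "finite ?K" by simp
  have expand: "schur \<mu> (xs @ [x, y]) = (\<Sum>\<kappa>\<in>?K. schur \<kappa> xs *
      (\<Sum>\<nu> | interlacing \<kappa> \<nu> \<and> interlacing \<nu> \<mu>.
         y ^ (sum_list \<mu> - sum_list \<nu>) * x ^ (sum_list \<nu> - sum_list \<kappa>)))" for x y
  proof -
    have "schur \<mu> (xs @ [x, y]) =
      (\<Sum>\<nu> | interlacing \<nu> \<mu>. y ^ (sum_list \<mu> - sum_list \<nu>) * schur \<nu> (xs @ [x]))"
      using schur_snoc[OF assms, of "xs @ [x]" y] by simp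
    also have "\<dots> = (\<Sum>\<nu> | interlacing \<nu> \<mu>. \<Sum>\<kappa> | interlacing \<kappa> \<nu>.
        schur \<kappa> xs * (y ^ (sum_list \<mu> - sum_list \<nu>) * x ^ (sum_list \<nu> - sum_list \<kappa>)))"
      by (intro sum.cong refl)
        (simp add: schur_snoc interlacing_decreasing sum_distrib_left mult_ac)
    also have "\<dots> = (\<Sum>\<nu> | interlacing \<nu> \<mu>. \<Sum>\<kappa> | \<kappa> \<in> ?K \<and> interlacing \<kappa> \<nu>.
        schur \<kappa> xs * (y ^ (sum_list \<mu> - sum_list \<nu>) * x ^ (sum_list \<nu> - sum_list \<kappa>)))"
      by (intro sum.cong refl) auto
    also have "\<dots> = (\<Sum>\<kappa>\<in>?K. \<Sum>\<nu> | \<nu> \<in> {\<nu>. interlacing \<nu> \<mu>} \<and> interlacing \<kappa> \<nu>.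
        schur \<kappa> xs * (y ^ (sum_list \<mu> - sum_list \<nu>) * x ^ (sum_list \<nu> - sum_list \<kappa>)))"
      by (rule sum.swap_restrict) (use fin finite_interlacing in auto)
    finally show ?thesis by (simp add: sum_distrib_left conj_commute)
  qed
  show ?thesis unfolding expand
    by (rule sum.cong[OF refl], rule arg_cong[OF sum_power_between_interlacing_commute])
qed

text \<open>Branching peels off the variables behind the pair one by one. The induction ranges over
  all decreasing shapes because each branching passes to smaller ones.\<close>

lemma schur_swap:
  fixes xs :: "'a::comm_semiring_1 list"
  assumes "sorted_wrt (\<ge>) \<mu>"
  shows "schur \<mu> (xs @ x # y # ys) = schur \<mu> (xs @ y # x # ys)"
  using assms
proof (induction ys arbitrary: \<mu> rule: rev_induct)
  case Nil
  show ?case using schur_snoc2_commute[OF Nil] .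
next
  case (snoc z ys)
  then show ?case
    using schur_snoc[OF snoc.prems, of "xs @ x # y # ys" z] schur_snoc[OF snoc.prems, of "xs @ y # x # ys" z]
    by (auto intro!: sum.cong arg_cong2[where f = "(*)"] interlacing_decreasing)
qed

lemma schur_rotate:
  fixes xs :: "'a::comm_semiring_1 list"
  assumes "sorted_wrt (\<ge>) \<mu>"
  shows "schur \<mu> (xs @ x # ys) = schur \<mu> (xs @ ys @ [x])"
proof (induction ys arbitrary: xs)
  case (Cons y ys)
  then show ?case using schur_swap[OF assms, of xs x y ys] Cons[of "xs @ [y]"] by simp
qed simp

text \<open>Reversal is the permutation that inverting \<open>q\<close> induces on the arguments
  \<open>q powi (- h), ..., q powi h\<close>.\<close>

lemma schur_rev:
  fixes xs :: "'a::comm_semiring_1 list"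
  assumes "sorted_wrt (\<ge>) \<mu>"
  shows "schur \<mu> (rev xs) = schur \<mu> xs"
proof -
  \<comment> \<open>The arbitrary tail \<open>ys\<close> lets the induction hypothesis absorb
    \<open>x\<close> into it; two rotations then bring \<open>x\<close> to the front.\<close>
  have "schur \<mu> (rev xs @ ys) = schur \<mu> (xs @ ys)" for ys
  proof (induction xs arbitrary: ys)
    case (Cons x xs)
    then show ?case using schur_rotate[OF assms, of "[]" x "xs @ ys"]
      schur_rotate[OF assms, of "xs" x "ys"] Cons[of "x # ys"] by simp
  qed simp
  from this[of "[]"] show ?thesis by simp
qed


section \<open>Schensted's correspondence\<close>

definition column_strict :: "'a::linorder list \<Rightarrow> 'a list \<Rightarrow> bool" where
  "column_strict r s \<longleftrightarrow> length s \<le> length r \<and> (\<forall>j<length s. r ! j < s ! j)"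

abbreviation first_row :: "'a list list \<Rightarrow> 'a list" where
  "first_row P \<equiv> (case P of [] \<Rightarrow> [] | r # _ \<Rightarrow> r)"

text \<open>A recursive form of semistandardness that does not mention the shape: insertion treats
  the first row and hands the bumped entry to the rest, so inductions run row by row. Excluding
  empty rows keeps zero parts out of the shape.\<close>

fun ssyt :: "'a::linorder list list \<Rightarrow> bool" where
  "ssyt [] \<longleftrightarrow> True"
| "ssyt (r # P) \<longleftrightarrow> r \<noteq> [] \<and> sorted r \<and> column_strict r (first_row P) \<and> ssyt P"

lemma column_strict_Nil [simp]: "column_strict r []"
  by (simp add: column_strict_def)

lemma ssyt_iff:
  "ssyt P \<longleftrightarrow> (\<forall>r\<in>set P. r \<noteq> [] \<and> sorted r) \<and>
     (\<forall>i. Suc i < length P \<longrightarrow> column_strict (P ! i) (P ! Suc i))"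
proof (induction P)
  case (Cons r P)
  have "(\<forall>i. Suc i < length (r # P) \<longrightarrow> column_strict ((r # P) ! i) ((r # P) ! Suc i)) \<longleftrightarrow>
    column_strict r (first_row P) \<and> (\<forall>i. Suc i < length P \<longrightarrow> column_strict (P ! i) (P ! Suc i))"
    by (cases P) (auto simp: nth_Cons split: nat.split)
  then show ?case using Cons by auto
qed simp

lemma zero_notin_shape: "ssyt P \<Longrightarrow> 0 \<notin> set (map length P)"
  by (auto simp: ssyt_iff)

text \<open>A decreasing shape supplies the length condition inside \<open>column_strict\<close>,
  and positive parts rule out empty rows.\<close>

lemma semistandard_iff_ssyt:
  assumes "sorted_wrt (\<ge>) \<mu>" and "\<forall>p\<in>set \<mu>. p > 0"
  shows "semistandard_tableau \<mu> T \<longleftrightarrow> ssyt T \<and> map length T = \<mu>"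
proof (cases "map length T = \<mu>")
  case True
  have "length (T ! Suc i) \<le> length (T ! i)" if "Suc i < length T" for i
    using assms(1) that unfolding True[symmetric] by (simp add: sorted_wrt_iff_nth_less)
  moreover have "\<forall>r\<in>set T. r \<noteq> []" using assms(2) unfolding True[symmetric] by auto
  ultimately show ?thesis
    by (auto simp: True semistandard_tableau_def ssyt_iff column_strict_def)
qed (auto simp: semistandard_tableau_def)

section \<open>Row insertion preserves semistandardness and content\<close>

lemma row_insert_None:
  "row_insert x r = (r', None) \<longleftrightarrow> r' = r @ [x] \<and> (\<forall>y\<in>set r. y \<le> x)"
proof (induction r arbitrary: r')
  case (Cons a r)
  have "row_insert x (a # r) = (r', None) \<longleftrightarrow>
    \<not> x < a \<and> (\<exists>s. row_insert x r = (s, None) \<and> r' = a # s)"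
    by (auto split: prod.splits)
  then show ?case by (auto simp: Cons.IH)
qed auto

lemma row_insert_Some:
  "row_insert x r = (r', Some y) \<longleftrightarrow>
     (\<exists>p<length r. r' = r[p := x] \<and> y = r ! p \<and> x < y \<and> (\<forall>j<p. r ! j \<le> x))"
proof (induction r arbitrary: r')
  case (Cons a r)
  show ?case
  proof (cases "x < a")
    case True
    then show ?thesis by (auto simp: Ex_less_Suc2)
  next
    case False
    have "row_insert x (a # r) = (r', Some y) \<longleftrightarrow> (\<exists>s. row_insert x r = (s, Some y) \<and> r' = a # s)"
      using False by (auto split: prod.splits)
    also have "\<dots> \<longleftrightarrow> (\<exists>p<length (a # r). r' = (a # r)[p := x] \<and> y = (a # r) ! p \<and> x < y \<and> (\<forall>j<p. (a # r) ! j \<le> x))"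
      using False by (auto simp: Cons.IH Ex_less_Suc2 All_less_Suc2)
    finally show ?thesis .
  qed
qed simp

lemma first_row_schensted_insert:
  "first_row (fst (schensted_insert x P)) = fst (row_insert x (first_row P))"
  by (cases P) (auto split: prod.splits option.splits)

lemma sorted_bump:
  assumes "sorted r" and "p < length r" and "x < r ! p" and "\<forall>j<p. r ! j \<le> x"
  shows "sorted (r[p := x])"
proof -
  have "r[p := x] ! i \<le> r[p := x] ! j" if "i \<le> j" "j < length r" for i j
    using assms that sorted_nth_mono[OF assms(1), of p j] sorted_nth_mono[OF assms(1), of i j]
    by (auto simp: nth_list_update)
  then show ?thesis by (auto simp: sorted_iff_nth_mono)
qed

text \<open>The bumped entry moves weakly to the left: below its old column \<open>p\<close> any
  entry of \<open>s\<close> exceeds \<open>y\<close>, so \<open>y\<close> settles in a column up to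
  \<open>p\<close>, where the entry above is smaller. Elsewhere the upper row has only
  decreased.\<close>

lemma column_strict_row_insert:
  assumes r: "sorted r" and s: "sorted s" and rs: "column_strict r s"
    and ins: "row_insert x r = (r', Some y)"
  shows "column_strict r' (fst (row_insert y s))"
proof -
  from ins obtain p where p: "p < length r" "r' = r[p := x]" "y = r ! p" "x < y" "\<And>j. j < p \<Longrightarrow> r ! j \<le> x"
    unfolding row_insert_Some by auto
  have len: "length s \<le> length r" and col: "\<And>j. j < length s \<Longrightarrow> r ! j < s ! j"
    using rs by (auto simp: column_strict_def)
  have lt: "r' ! j < s ! j" if "j < length s" for j
    using col[OF that] p that len by (cases "j = p") auto
  \<comment> \<open>Before \<open>p\<close> the entries are at most \<open>x\<close>, at
    \<open>p\<close> the entry is \<open>x\<close>, and \<open>x < y\<close>.\<close>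
  have small: "r' ! j < y" if "j \<le> p" for j
    using p(1-4) p(5)[of j] that by (cases "j = p") auto
  show ?thesis
  proof (cases "row_insert y s")
    case (Pair s' b)
    show ?thesis
    proof (cases b)
      case None
      then have s': "row_insert y s = (s @ [y], None)" "\<forall>z\<in>set s. z \<le> y"
        using Pair row_insert_None by blast+
      have "length s \<le> p"
      proof (rule ccontr)
        assume "\<not> length s \<le> p"
        then have "s ! p \<le> y" "y < s ! p" using s' col[of p] p by auto
        then show False by simp
      qed
      then have "r' ! length s < y" "length s < length r'" using small p by auto
      then show ?thesis
        using lt by (auto simp: s'(1) column_strict_def nth_append less_Suc_eq)
    next
      case (Some z)
      then obtain k where k: "k < length s" "s' = s[k := y]" "y < s ! k" "\<forall>j<k. s ! j \<le> y"
        using Pair row_insert_Some by metis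
      have "k \<le> p"
      proof (rule ccontr)
        assume "\<not> k \<le> p"
        then have "s ! p \<le> y" "y < s ! p" using k col[of p] p by auto
        then show False by simp
      qed
      then have "r' ! k < y" using small by simp
      then show ?thesis
        using lt len k(1) p(2) unfolding Pair k(2) by (auto simp: column_strict_def nth_list_update)
    qed
  qed
qed

lemma ssyt_schensted_insert: "ssyt P \<Longrightarrow> ssyt (fst (schensted_insert x P))"
proof (induction P arbitrary: x)
  case (Cons r P)
  obtain r' b where rb: "row_insert x r = (r', b)" by (cases "row_insert x r")
  show ?case
  proof (cases b)
    case None
    then have r': "r' = r @ [x]" "\<forall>y\<in>set r. y \<le> x" using rb row_insert_None by blast+
    moreover have "column_strict r' (first_row P)"
      using Cons.prems r' by (auto simp: column_strict_def nth_append)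
    ultimately show ?thesis using Cons.prems by (auto simp: rb None sorted_append)
  next
    case (Some y)
    obtain P' i where P': "schensted_insert y P = (P', i)" by (cases "schensted_insert y P")
    have "sorted (first_row P)" using Cons.prems by (cases P) auto
    then have "column_strict r' (first_row P')"
      using column_strict_row_insert[of r "first_row P" x r' y] Cons.prems rb Some
        first_row_schensted_insert[of y P] P' by auto
    moreover have "r' \<noteq> []" "sorted r'"
      using rb Some Cons.prems sorted_bump by (auto simp: row_insert_Some)
    ultimately show ?thesis using Cons.IH[of y] Cons.prems P' by (auto simp: rb Some)
  qed
qed simp

lemma mset_row_insert:
  "row_insert x r = (r', b) \<Longrightarrow>
     add_mset x (mset r) = mset r' + (case b of None \<Rightarrow> {#} | Some y \<Rightarrow> {#y#})"
  by (induction r arbitrary: r') (auto split: prod.splits if_splits)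

lemma mset_schensted_insert:
  "mset (concat (fst (schensted_insert x P))) = add_mset x (mset (concat P))"
proof (induction P arbitrary: x)
  case (Cons r P)
  obtain r' b where rb: "row_insert x r = (r', b)" by (cases "row_insert x r")
  then show ?case
    using mset_row_insert[OF rb] Cons.IH
    by (cases b) (auto split: prod.splits, metis fst_conv union_mset_add_mset_left union_mset_add_mset_right)
qed simp

section \<open>Growth of shapes, and reversing an insertion\<close>

definition add_part :: "nat \<Rightarrow> nat list \<Rightarrow> nat list" where
  "add_part i s = (if i < length s then s[i := Suc (s ! i)] else s @ [1])"

lemma length_row_insert:
  "length (fst (row_insert x r)) = (case snd (row_insert x r) of None \<Rightarrow> Suc (length r) | Some y \<Rightarrow> length r)"
  by (induction r) (auto split: prod.splits option.splits)

lemma shape_schensted_insert: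
  "schensted_insert x P = (P', i) \<Longrightarrow> i \<le> length P \<and> map length P' = add_part i (map length P)"
proof (induction P arbitrary: x P' i)
  case (Cons r P)
  obtain r' b where rb: "row_insert x r = (r', b)" by (cases "row_insert x r")
  show ?case
  proof (cases b)
    case None
    then show ?thesis using Cons.prems rb length_row_insert[of x r] by (auto simp: add_part_def)
  next
    case (Some y)
    obtain P'' i' where P'': "schensted_insert y P = (P'', i')" by (cases "schensted_insert y P")
    then show ?thesis using Cons.prems Cons.IH[OF P''] rb Some length_row_insert[of x r]
      by (cases "i' < length P") (auto simp: add_part_def)
  qed
qed (auto simp: add_part_def)

text \<open>If one list gained a new part 1 where the other had a part increased to 1, the latter
  would have contained a zero.\<close>

lemma add_part_inject:
  assumes "add_part i s = add_part i t" and "i \<le> length s" and "i \<le> length t"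
    and "0 \<notin> set s" and "0 \<notin> set t"
  shows "s = t"
proof (cases "i < length s"; cases "i < length t")
  assume "i < length s" "i < length t"
  then have eq: "s[i := Suc (s ! i)] = t[i := Suc (t ! i)]" using assms(1) by (simp add: add_part_def)
  then have "s ! i = t ! i" using \<open>i < length s\<close> \<open>i < length t\<close> by (metis nat.inject nth_list_update_eq)
  then show ?thesis by (metis eq list_update_id list_update_overwrite)
next
  assume a: "i < length s" "\<not> i < length t"
  then have "s[i := Suc (s ! i)] = t @ [1]" "i = length t" using assms by (auto simp: add_part_def)
  then have "Suc (s ! i) = 1" using a(1) by (metis nth_append_length nth_list_update_eq)
  then show ?thesis using a(1) assms(4) by (metis One_nat_def nat.inject nth_mem)
next
  assume a: "\<not> i < length s" "i < length t"
  then have "t[i := Suc (t ! i)] = s @ [1]" "i = length s" using assms by (auto simp: add_part_def)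
  then have "Suc (t ! i) = 1" using a(2) by (metis nth_append_length nth_list_update_eq)
  then show ?thesis using a(2) assms(5) by (metis One_nat_def nat.inject nth_mem)
qed (use assms in \<open>auto simp: add_part_def\<close>)

text \<open>Were \<open>y\<close> bumped from positions \<open>p1 < p2\<close>, the row
  \<open>r1\<close> would hold \<open>y\<close> at \<open>p1\<close> and the smaller
  \<open>x2\<close> at \<open>p2\<close>, against sortedness; the other order is symmetric.\<close>

lemma row_insert_Some_inject:
  assumes "row_insert x1 r1 = (r, Some y)" and "row_insert x2 r2 = (r, Some y)"
    and "sorted r1" and "sorted r2"
  shows "x1 = x2 \<and> r1 = r2"
proof -
  obtain p1 where p1: "p1 < length r1" "r = r1[p1 := x1]" "y = r1 ! p1" "x1 < y"
    using assms(1) unfolding row_insert_Some by auto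
  obtain p2 where p2: "p2 < length r2" "r = r2[p2 := x2]" "y = r2 ! p2" "x2 < y"
    using assms(2) unfolding row_insert_Some by auto
  have len: "length r1 = length r2" using p1 p2 by (metis length_list_update)
  have "\<not> p1 < p2"
  proof
    assume "p1 < p2"
    then have "x2 = r1 ! p2" using p1 p2 len by (metis nat_neq_iff nth_list_update_eq nth_list_update_neq)
    moreover have "r1 ! p1 \<le> r1 ! p2" using \<open>p1 < p2\<close> p2 len assms(3) by (simp add: sorted_nth_mono)
    ultimately show False using p1 p2 by simp
  qed
  moreover have "\<not> p2 < p1"
  proof
    assume "p2 < p1"
    then have "x1 = r2 ! p1" using p1 p2 len by (metis nat_neq_iff nth_list_update_eq nth_list_update_neq)
    moreover have "r2 ! p2 \<le> r2 ! p1" using \<open>p2 < p1\<close> p1 len assms(4) by (simp add: sorted_nth_mono)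
    ultimately show False using p1 p2 by simp
  qed
  ultimately have "p1 = p2" by simp
  then show ?thesis
    using p1 p2 by (metis list_update_id list_update_overwrite nth_list_update_eq)
qed

text \<open>The index \<open>i\<close> separates the cases: zero means that the letter was appended
  to the first row or opened it. Otherwise the rows below determine the ejected entry by induction,
  and reverse bumping restores the first row.\<close>

lemma schensted_insert_inject:
  assumes "schensted_insert x1 P1 = (P, i)" and "schensted_insert x2 P2 = (P, i)"
    and "ssyt P1" and "ssyt P2"
  shows "x1 = x2 \<and> P1 = P2"
  using assms
proof (induction P1 arbitrary: x1 P2 x2 P i)
  case Nil
  then show ?case
    by (cases P2) (auto split: prod.splits option.splits simp: row_insert_None)
next
  case (Cons r1 P1)
  show ?case
  proof (cases P2)
    case Nil
    then show ?thesis using Cons.prems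
      by (auto split: prod.splits option.splits simp: row_insert_None)
  next
    case P2: (Cons r2 P2')
    obtain r1' b1 where rb1: "row_insert x1 r1 = (r1', b1)" by (cases "row_insert x1 r1")
    obtain r2' b2 where rb2: "row_insert x2 r2 = (r2', b2)" by (cases "row_insert x2 r2")
    show ?thesis
    proof (cases b1)
      case None
      then have "b2 = None" using Cons.prems rb1 rb2 P2 by (auto split: option.splits prod.splits)
      with None show ?thesis using Cons.prems rb1 rb2 P2 by (auto simp: row_insert_None)
    next
      case b1: (Some y1)
      then obtain y2 where b2: "b2 = Some y2"
        using Cons.prems rb1 rb2 P2 by (cases b2) (auto split: prod.splits)
      obtain P1'' i1 where P1'': "schensted_insert y1 P1 = (P1'', i1)" by (cases "schensted_insert y1 P1")
      obtain P2'' i2 where P2'': "schensted_insert y2 P2' = (P2'', i2)" by (cases "schensted_insert y2 P2'")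
      have eq: "P2'' = P1''" "i2 = i1" "r2' = r1'"
        using Cons.prems rb1 rb2 b1 b2 P1'' P2'' P2 by auto
      then have "y1 = y2 \<and> P1 = P2'"
        using Cons.IH[OF P1'', of y2 P2'] P2'' Cons.prems P2 by simp
      then show ?thesis
        using row_insert_Some_inject[of x1 r1 r1' y1 x2 r2] rb1 rb2 b1 b2 eq Cons.prems P2 by simp
    qed
  qed
qed

text \<open>
  The last conjunct locates the ejected entry \<open>x\<close> in the first row of \<open>P\<close>; it is what makes the
  row above, in which \<open>x\<close> in turn displaces an entry, column-strict again.
\<close>

lemma schensted_insert_surj_aux:
  assumes "ssyt P" and "i < length P" and "Suc i < length P \<longrightarrow> length (P ! Suc i) < length (P ! i)"
  shows "\<exists>x P'. ssyt P' \<and> schensted_insert x P' = (P, i) \<and>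
    (\<exists>k<length (first_row P). first_row P ! k = x \<and>
      length (first_row P') \<le> length (first_row P) \<and>
      (\<forall>j<length (first_row P'). first_row P ! j \<le> first_row P' ! j \<and> (k \<le> j \<longrightarrow> x < first_row P' ! j)))"
  using assms
proof (induction P arbitrary: i)
  case (Cons r P)
  show ?case
  proof (cases i)
    case 0
    obtain s x where r: "r = s @ [x]" using Cons.prems(1) by (metis rev_exhaust ssyt.simps(2))
    have s: "sorted s" "\<forall>y\<in>set s. y \<le> x" using Cons.prems(1) r by (auto simp: sorted_append)
    show ?thesis
    proof (cases "s = []")
      case True
      \<comment> \<open>A corner in a row of length one leaves no room for a nonempty row
        below.\<close>
      have "P = []"
        using Cons.prems 0 r True by (cases P) auto
      then have "ssyt [] \<and> schensted_insert x [] = (r # P, i)" using r True 0 by simp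
      then show ?thesis using r by (intro exI[of _ x] exI[of _ "[]"]) auto
    next
      case False
      have "column_strict s (first_row P)"
      proof -
        have "length (first_row P) \<le> length s"
          using Cons.prems 0 r by (cases P) auto
        then show ?thesis using Cons.prems(1) r by (auto simp: column_strict_def nth_append)
      qed
      then have "ssyt (s # P)" using Cons.prems(1) s False by auto
      moreover have "row_insert x s = (r, None)" using s r by (simp add: row_insert_None)
      then have "schensted_insert x (s # P) = (r # P, i)" using 0 by simp
      ultimately show ?thesis
        using r by (intro exI[of _ x] exI[of _ "s # P"]) (auto simp: nth_append intro!: exI[of _ "length s"])
    qed
  next
    case (Suc i')
    from Cons.IH[of i'] Cons.prems Suc obtain y P' k where
      P': "ssyt P'" "schensted_insert y P' = (P, i')" and
      k: "k < length (first_row P)" "first_row P ! k = y" and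
      le: "length (first_row P') \<le> length (first_row P)" and
      ge: "\<And>j. j < length (first_row P') \<Longrightarrow> first_row P ! j \<le> first_row P' ! j" and
      gt: "\<And>j. j < length (first_row P') \<Longrightarrow> k \<le> j \<Longrightarrow> y < first_row P' ! j"
      by auto
    have below: "column_strict r (first_row P)" and sr: "sorted r" "r \<noteq> []" using Cons.prems(1) by auto
    \<comment> \<open>Reverse bumping: \<open>y\<close> returns to the last entry smaller than
      itself. Such entries exist, since in column \<open>k\<close> the entry of \<open>r\<close>
      lies above \<open>y\<close>.\<close>
    define p where "p = Max {p. p < length r \<and> r ! p < y}"
    have k': "k \<in> {p. p < length r \<and> r ! p < y}"
      using below k by (auto simp: column_strict_def)
    have fin: "finite {p. p < length r \<and> r ! p < y}" by simp
    have p: "p < length r" "r ! p < y" "k \<le> p"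
      using Max_in[OF fin] Max_ge[OF fin k'] k' unfolding p_def by blast+
    have after: "y \<le> r ! j" if "p < j" "j < length r" for j
      using Max_ge[OF fin, of j] that unfolding p_def by (metis (mono_tags, lifting) leD leI mem_Collect_eq)
    define s where "s = r[p := y]"
    have "s ! a \<le> s ! b" if "a \<le> b" "b < length r" for a b
      using that after p sorted_nth_mono[OF sr(1), of a b] sorted_nth_mono[OF sr(1), of a p]
      by (cases "a = p"; cases "b = p") (auto simp: s_def)
    then have ss: "sorted s" by (auto simp: sorted_iff_nth_mono s_def)
    have ins: "row_insert (r ! p) s = (r, Some y)"
      unfolding row_insert_Some
      using p sorted_nth_mono[OF sr(1), of _ p] by (intro exI[of _ p]) (auto simp: s_def)
    \<comment> \<open>In column \<open>p\<close> the upper entry is now \<open>y\<close>, which is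
      smaller than the entries of the restored row from column \<open>k\<close> on; in the other
      columns the upper entry is unchanged and the lower one has not decreased.\<close>
    have "s ! j < first_row P' ! j" if "j < length (first_row P')" for j
    proof (cases "j = p")
      case True
      then show ?thesis using gt[OF that] p by (simp add: s_def)
    next
      case False
      then have "s ! j = r ! j" by (simp add: s_def)
      also have "\<dots> < first_row P ! j" using below that le by (simp add: column_strict_def)
      also have "\<dots> \<le> first_row P' ! j" using ge[OF that] .
      finally show ?thesis .
    qed
    then have "column_strict s (first_row P')"
      using below le by (auto simp: column_strict_def s_def)
    then have "ssyt (s # P')" using P' ss sr by (auto simp: s_def)
    moreover have "schensted_insert (r ! p) (s # P') = (r # P, i)" using ins P' Suc by simp
    moreover have "r ! j \<le> s ! j \<and> (p \<le> j \<longrightarrow> r ! p < s ! j)" if "j < length r" for j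
      using that p after[of j] by (cases "j = p") (auto simp: s_def intro: less_le_trans)
    ultimately show ?thesis
      using p by (intro exI[of _ "r ! p"] exI[of _ "s # P'"]) (auto simp: s_def intro!: exI[of _ p])
  qed
qed simp

lemma schensted_insert_surj:
  assumes "ssyt P" and "i < length P" and "Suc i < length P \<Longrightarrow> length (P ! Suc i) < length (P ! i)"
  obtains x P' where "ssyt P'" and "schensted_insert x P' = (P, i)"
  using schensted_insert_surj_aux[of P i] assms by blast

section \<open>Schensted's correspondence for words\<close>

lemma schensted_Nil [simp]: "schensted [] = ([], [])"
  by (simp add: schensted_def)

lemma schensted_snoc:
  "schensted (xs @ [x]) =
     (fst (schensted_insert x (fst (schensted xs))),
      add_cell (Suc (length xs)) (snd (schensted_insert x (fst (schensted xs)))) (snd (schensted xs)))"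
  by (simp add: schensted_def enumerate_append_eq split: prod.splits)

lemma shape_add_cell:
  "i \<le> length Q \<Longrightarrow> map length (add_cell k i Q) = add_part i (map length Q)"
  by (auto simp: add_cell_def add_part_def map_update)

lemma set_add_cell:
  "i \<le> length Q \<Longrightarrow> set (concat (add_cell k i Q)) = insert k (set (concat Q))"
proof (cases "i < length Q")
  case True
  then have "Q[i := Q ! i @ [k]] = take i Q @ (Q ! i @ [k]) # drop (Suc i) Q"
    by (simp add: upd_conv_take_nth_drop)
  moreover have "set (concat Q) = set (concat (take i Q @ Q ! i # drop (Suc i) Q))"
    using True by (metis id_take_nth_drop)
  ultimately show ?thesis using True by (auto simp: add_cell_def)
qed (simp add: add_cell_def)

lemma schensted_invariants:
  "ssyt (fst (schensted xs)) \<and> mset (concat (fst (schensted xs))) = mset xs \<and>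
   map length (snd (schensted xs)) = map length (fst (schensted xs)) \<and>
   set (concat (snd (schensted xs))) = {1..length xs}"
proof (induction xs rule: rev_induct)
  case (snoc x xs)
  obtain P Q where PQ: "schensted xs = (P, Q)" by (cases "schensted xs")
  obtain P' i where P': "schensted_insert x P = (P', i)" by (cases "schensted_insert x P")
  note sh = shape_schensted_insert[OF P']
  have len: "length Q = length P" using snoc PQ by (metis fst_conv length_map snd_conv)
  have "{1..Suc (length xs)} = insert (Suc (length xs)) {1..length xs}" by auto
  then show ?case
    using snoc PQ P' sh len ssyt_schensted_insert[of P x] mset_schensted_insert[of x P]
    by (auto simp: schensted_snoc shape_add_cell set_add_cell simp del: set_concat)
qed simp

text \<open>The new label lies in exactly one row, which reveals the index. Deleting the label, and
  the row if that empties it, recovers the tableau.\<close>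

lemma add_cell_inject:
  assumes "add_cell k i Q = add_cell k j R" and "i \<le> length Q" and "j \<le> length R"
    and "k \<notin> set (concat Q)" and "k \<notin> set (concat R)" and "[] \<notin> set Q" and "[] \<notin> set R"
  shows "i = j \<and> Q = R"
proof -
  have row: "k \<in> set (add_cell k i Q ! l) \<longleftrightarrow> l = i"
    if "i \<le> length Q" "k \<notin> set (concat Q)" "l < length (add_cell k i Q)" for i l and Q
    using that by (auto simp: add_cell_def nth_append nth_list_update)
  have lt: "i < length (add_cell k i Q)" if "i \<le> length Q" for i and Q
    using that by (auto simp: add_cell_def)
  have rem: "filter (\<lambda>r. r \<noteq> []) (map (filter (\<lambda>t. t \<noteq> k)) (add_cell k i Q)) = Q"
    if "i \<le> length Q" "k \<notin> set (concat Q)" "[] \<notin> set Q" for i Q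
  proof -
    have id: "map (filter (\<lambda>t. t \<noteq> k)) Q = Q" "filter (\<lambda>r. r \<noteq> []) Q = Q"
      using that by (auto intro!: map_idI simp: filter_id_conv)
    show ?thesis
    proof (cases "i < length Q")
      case True
      then have "map (filter (\<lambda>t. t \<noteq> k)) (add_cell k i Q) =
        (map (filter (\<lambda>t. t \<noteq> k)) Q)[i := filter (\<lambda>t. t \<noteq> k) (Q ! i)]"
        by (simp add: add_cell_def map_update)
      also have "\<dots> = Q" using True id(1) by (metis list_update_id nth_map)
      finally show ?thesis using id by simp
    qed (use id in \<open>simp add: add_cell_def\<close>)
  qed
  have "i = j" using row[of i Q i] row[of j R i] lt assms by metis
  moreover have "Q = R" using rem[of i Q] rem[of j R] assms by metis
  ultimately show ?thesis by simp
qed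

text \<open>The last letter is undone: the largest label of the recording tableau names the row
  where insertion ended, and reverse insertion from there is unique.\<close>

lemma schensted_inject: "schensted xs = schensted ys \<Longrightarrow> xs = ys"
proof (induction xs arbitrary: ys rule: rev_induct)
  case Nil
  then show ?case using schensted_invariants[of ys] by (metis concat.simps(1) fst_conv mset_zero_iff schensted_Nil)
next
  case (snoc x xs)
  \<comment> \<open>The labels of the common recording tableau reveal the length of both
    words.\<close>
  have "{1..length (xs @ [x])} = {1..length ys}"
    using schensted_invariants[of "xs @ [x]"] schensted_invariants[of ys] snoc.prems by metis
  then have len: "length ys = Suc (length xs)"
    by (metis card_atLeastAtMost diff_Suc_1 length_append_singleton)
  then obtain zs z where ys: "ys = zs @ [z]" by (metis length_Suc_conv_rev)
  obtain P Q where PQ: "schensted xs = (P, Q)" by (cases "schensted xs")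
  obtain R S where RS: "schensted zs = (R, S)" by (cases "schensted zs")
  obtain P' i where P': "schensted_insert x P = (P', i)" by (cases "schensted_insert x P")
  obtain R' j where R': "schensted_insert z R = (R', j)" by (cases "schensted_insert z R")
  have inv: "ssyt P" "map length Q = map length P" "set (concat Q) = {1..length xs}"
    "ssyt R" "map length S = map length R" "set (concat S) = {1..length xs}"
    using schensted_invariants[of xs] schensted_invariants[of zs] PQ RS len ys by auto
  have eq: "P' = R'" "add_cell (Suc (length xs)) i Q = add_cell (Suc (length xs)) j S"
    using snoc.prems PQ RS P' R' len by (auto simp: ys schensted_snoc)
  have "length Q = length P" "length S = length R" using inv by (metis length_map)+
  moreover have "[] \<notin> set Q" "[] \<notin> set S"
    using zero_notin_shape[OF inv(1)] zero_notin_shape[OF inv(4)] unfolding inv(2,5)[symmetric] by auto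
  ultimately have "i = j \<and> Q = S"
    using eq(2) shape_schensted_insert[OF P'] shape_schensted_insert[OF R'] inv
    by (intro add_cell_inject) (auto simp del: set_concat)
  moreover from this have "x = z \<and> P = R"
    using schensted_insert_inject[of x P P' i z R] P' R' eq inv by simp
  ultimately show ?case using snoc.IH[of zs] PQ RS ys by simp
qed

text \<open>The largest label ends its row by sortedness, and a cell below it would need a larger
  label. So it occupies a corner, where reverse insertion can start.\<close>

lemma standard_remove_largest:
  fixes Q :: "nat list list"
  assumes Q: "ssyt Q" and dist: "distinct (concat Q)" and set: "set (concat Q) = {1..Suc n}"
  obtains i R where "ssyt R" and "distinct (concat R)" and "set (concat R) = {1..n}"
    and "i \<le> length R" and "Q = add_cell (Suc n) i R"
    and "i < length Q" and "Suc i < length Q \<Longrightarrow> length (Q ! Suc i) < length (Q ! i)"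
proof -
  have "Suc n \<in> set (concat Q)" using set by simp
  then obtain i where i: "i < length Q" "Suc n \<in> set (Q ! i)" by (auto simp: in_set_conv_nth[of _ Q])
  have rows: "\<And>l. l < length Q \<Longrightarrow> Q ! l \<noteq> [] \<and> sorted (Q ! l)"
    and cols: "\<And>l. Suc l < length Q \<Longrightarrow> column_strict (Q ! l) (Q ! Suc l)"
    using Q by (auto simp: ssyt_iff)
  have bd: "t \<le> Suc n" if "t \<in> set (Q ! l)" "l < length Q" for t l
  proof -
    have "t \<in> set (concat Q)" using that by auto
    then show ?thesis unfolding set by simp
  qed
  obtain s where s: "Q ! i = s @ [Suc n]"
  proof -
    obtain s t where st: "Q ! i = s @ [t]" using rows[OF i(1)] by (metis rev_exhaust)
    moreover have "t = Suc n"
      using rows[OF i(1)] bd[of t i] i st by (auto simp: sorted_append)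
    ultimately show ?thesis using that by simp
  qed
  have nobelow: "\<not> length s < length (Q ! Suc i)" if "Suc i < length Q"
  proof
    assume *: "length s < length (Q ! Suc i)"
    then have "Q ! i ! length s < Q ! Suc i ! length s"
      using cols[OF that] by (simp add: column_strict_def)
    moreover have "Q ! Suc i ! length s \<le> Suc n" using bd[OF nth_mem[OF *] that] .
    ultimately show False using s by simp
  qed
  have corner: "length (Q ! Suc i) < length (Q ! i)" if "Suc i < length Q"
    using nobelow[OF that] s by simp
  \<comment> \<open>A row consisting of the label alone disappears. It is the last row, since a
    nonempty row after it would put a cell below the label.\<close>
  define R where "R = (if s = [] then take i Q else Q[i := s])"
  have last: "Suc i = length Q" if "s = []"
    using nobelow rows[of "Suc i"] i(1) that by force
  have add: "Q = add_cell (Suc n) i R" and iR: "i \<le> length R"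
  proof -
    show "Q = add_cell (Suc n) i R"
    proof (cases "s = []")
      case True
      then show ?thesis using last s i(1) take_Suc_conv_app_nth[OF i(1)] by (simp add: R_def add_cell_def)
    next
      case False
      then have "add_cell (Suc n) i R = Q[i := s @ [Suc n]]"
        using i(1) by (simp add: R_def add_cell_def)
      then show ?thesis by (simp only: list_update_id flip: s)
    qed
    show "i \<le> length R" using i(1) by (simp add: R_def)
  qed
  have ms: "mset (concat Q) = add_mset (Suc n) (mset (concat R))"
  proof -
    have "Q = take i Q @ (s @ [Suc n]) # drop (Suc i) Q" using i(1) s by (metis id_take_nth_drop)
    then have "concat Q = concat (take i Q) @ s @ [Suc n] @ concat (drop (Suc i) Q)"
      by (metis append.assoc concat.simps(2) concat_append)
    moreover have "concat R = concat (take i Q) @ s @ concat (drop (Suc i) Q)"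
      using last i(1) by (simp add: R_def upd_conv_take_nth_drop)
    ultimately show ?thesis by simp
  qed
  have dR: "distinct (concat R)" and nR: "Suc n \<notin> set (concat R)"
  proof -
    have "distinct (Suc n # concat R)" using dist ms by (metis mset.simps(2) mset_eq_imp_distinct_iff)
    then show "distinct (concat R)" "Suc n \<notin> set (concat R)" by auto
  qed
  have "set (concat Q) = insert (Suc n) (set (concat R))"
    using ms by (metis set_mset_add_mset_insert set_mset_mset)
  moreover have "{1..n} = {1..Suc n} - {Suc n}" by auto
  ultimately have sR: "set (concat R) = {1..n}" using nR set by (metis Diff_insert_absorb)
  have "ssyt R"
  proof (cases "s = []")
    case True
    then show ?thesis using rows cols i(1) by (auto simp: R_def ssyt_iff in_set_conv_nth)
  next
    case False
    have "column_strict (R ! l) (R ! Suc l)" if l: "Suc l < length Q" for l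
    proof -
      consider "l = i" | "Suc l = i" | "l \<noteq> i" "Suc l \<noteq> i" by auto
      then show ?thesis
      proof cases
        case 1
        have "column_strict s (Q ! Suc i)"
          using cols[of i] nobelow l 1 by (auto simp: column_strict_def s nth_append)
        then show ?thesis using 1 False i(1) by (simp add: R_def)
      next
        case 2
        have "length (Q ! i) = Suc (length s)" "\<And>j. j < length s \<Longrightarrow> Q ! i ! j = s ! j"
          by (simp_all add: s nth_append)
        then have "column_strict (Q ! l) s" using cols[OF l] 2
          unfolding column_strict_def by (metis Suc_leD less_SucI)
        then show ?thesis using 2 False i(1) by (auto simp: R_def)
      qed (use cols[OF l] False in \<open>auto simp: R_def\<close>)
    qed
    moreover have "R ! l \<noteq> [] \<and> sorted (R ! l)" if "l < length Q" for l
      using rows[OF that] s False that by (cases "l = i") (auto simp: R_def sorted_append)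
    ultimately show ?thesis using False by (auto simp: ssyt_iff in_set_conv_nth R_def)
  qed
  then show ?thesis using that dR sR iR add i(1) corner by blast
qed

text \<open>The cell of the largest label of \<open>Q\<close> is a corner of \<open>P\<close> as
  well, because the shapes agree. Reverse insertion from it yields the last letter and a tableau
  whose shape is again that of the reduced recording tableau.\<close>

lemma schensted_surj:
  fixes P :: "'a::linorder list list"
  assumes "ssyt Q" and "distinct (concat Q)" and "set (concat Q) = {1..n}"
    and "ssyt P" and "map length P = map length Q"
  shows "\<exists>xs. length xs = n \<and> schensted xs = (P, Q)"
  using assms
proof (induction n arbitrary: P Q)
  case 0
  then have "Q = []" by (cases Q) auto
  then show ?case using 0 by simp
next
  case (Suc n)
  obtain i R where R: "ssyt R" "distinct (concat R)" "set (concat R) = {1..n}" "i \<le> length R"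
    "Q = add_cell (Suc n) i R" "i < length Q" "Suc i < length Q \<Longrightarrow> length (Q ! Suc i) < length (Q ! i)"
    by (rule standard_remove_largest[OF Suc.prems(1-3)]) blast
  have len: "length P = length Q" using Suc.prems(5) by (metis length_map)
  have "length (P ! j) = length (Q ! j)" if "j < length Q" for j
    using Suc.prems(5) that len by (metis nth_map)
  then have "Suc i < length P \<Longrightarrow> length (P ! Suc i) < length (P ! i)" and "i < length P"
    using R(6,7) len by auto
  then obtain x P' where P': "ssyt P'" "schensted_insert x P' = (P, i)"
    using schensted_insert_surj[OF Suc.prems(4)] by blast
  have "add_part i (map length P') = add_part i (map length R)"
    using Suc.prems(5) shape_schensted_insert[OF P'(2)] shape_add_cell[OF R(4), of "Suc n"] R(5) by simp
  then have "map length P' = map length R"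
    by (rule add_part_inject)
      (use shape_schensted_insert[OF P'(2)] R(4) zero_notin_shape[OF R(1)] zero_notin_shape[OF P'(1)] in simp_all)
  then obtain xs where "length xs = n" "schensted xs = (P', R)"
    using Suc.IH[OF R(1-3) P'(1)] by auto
  then have "length (xs @ [x]) = Suc n \<and> schensted (xs @ [x]) = (P, Q)"
    using P'(2) R(5) by (simp add: schensted_snoc)
  then show ?case by blast
qed

section \<open>Insertion under strictly increasing maps\<close>

lemma row_insert_map:
  assumes "strict_mono f"
  shows "row_insert (f x) (map f r) = map_prod (map f) (map_option f) (row_insert x r)"
  by (induction r) (auto split: prod.splits simp: strict_mono_less[OF assms])

lemma schensted_insert_map:
  assumes "strict_mono f"
  shows "schensted_insert (f x) (map (map f) P) = map_prod (map (map f)) id (schensted_insert x P)"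
proof (induction P arbitrary: x)
  case (Cons r P)
  obtain r' b where rb: "row_insert x r = (r', b)" by (cases "row_insert x r")
  then show ?case using Cons by (cases b) (auto simp: row_insert_map[OF assms] split: prod.splits)
qed simp

text \<open>Insertion only compares entries. This covers both positive scaling of real points and
  the casts between natural, integer and real coordinates.\<close>

lemma recording_tableau_map:
  assumes "strict_mono f"
  shows "recording_tableau (map f xs) = recording_tableau xs"
proof -
  have "schensted (map f xs) = map_prod (map (map f)) id (schensted xs)"
    by (induction xs rule: rev_induct) (auto simp: schensted_snoc schensted_insert_map[OF assms])
  then show ?thesis by (simp add: recording_tableau_def)
qed


section \<open>Expansion in quantum integers\<close>

lemma inverse_q: "inverse q = fls_X_inv"
  by (rule inverse_unique) (simp add: fls_X_inv_times_conv_shift)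

lemma q_power_int_nth: "(q powi n) $$ k = (if k = n then 1 else 0)"
  by (auto simp: power_int_def inverse_q)

lemma q_diff_times_nth: "((q - q powi (-1)) * S) $$ k = S $$ (k - 1) - S $$ (k + 1)"
  by (simp add: power_int_minus inverse_q left_diff_distrib fls_X_times_conv_shift
      fls_X_inv_times_conv_shift)

lemma q_diff_nonzero: "q - q powi (-1) \<noteq> 0"
proof
  assume "q - q powi (-1) = 0"
  then have "(q - q powi (-1)) $$ 1 = 0" by simp
  then show False unfolding fls_minus_nth q_power_int_nth by simp
qed

text \<open>Multiplication by \<open>q - q powi (-1)\<close> clears the denominators and turns
  \<open>q_int k\<close> into a difference of two monomials, so the coefficients can be read
  off.\<close>

lemma q_int_combination_nth:
  assumes fin: "finite {k. a k \<noteq> (0::int)}" and zero: "a 0 = 0"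
  shows "((q - q powi (-1)) * (\<Sum>k | a k \<noteq> 0. of_int (a k) * q_int k)) $$ n =
    of_int (if n \<ge> 0 then a (nat n) else - a (nat (- n)))"
proof -
  have "(q - q powi (-1)) * (of_int (a k) * q_int k) =
    of_int (a k) * (q powi int k - q powi (- int k))" for k
    using q_diff_nonzero by (simp add: q_int_def)
  then have "(q - q powi (-1)) * (\<Sum>k | a k \<noteq> 0. of_int (a k) * q_int k) =
    (\<Sum>k | a k \<noteq> 0. of_int (a k) * (q powi int k - q powi (- int k)))"
    by (simp only: sum_distrib_left)
  then have "((q - q powi (-1)) * (\<Sum>k | a k \<noteq> 0. of_int (a k) * q_int k)) $$ n =
    (\<Sum>k | a k \<noteq> 0. of_int (a k) * ((if n = int k then 1 else 0) - (if n = - int k then 1 else 0)))"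
    by (simp only: fls_nth_sum fls_mult_of_int_nth fls_minus_nth q_power_int_nth)
  \<comment> \<open>Only \<open>k = |n|\<close> can contribute, with the sign of \<open>n\<close>;
    for \<open>n = 0\<close> this index is absent from the sum, matching the value
    \<open>a 0 = 0\<close>.\<close>
  also have "\<dots> = (\<Sum>k | a k \<noteq> 0. (if k = nat \<bar>n\<bar> then
      of_int (if n \<ge> 0 then a (nat n) else - a (nat (- n))) else 0))"
    by (intro sum.cong refl) (use zero in \<open>auto split: if_splits\<close>)
  also have "\<dots> = of_int (if n \<ge> 0 then a (nat n) else - a (nat (- n)))"
    using fin by (simp add: sum.delta')
  finally show ?thesis .
qed

text \<open>Uniqueness for the definite description in \<open>plethysm_coeff\<close>.\<close>

lemma q_int_expansion_unique:
  assumes "finite {k. a k \<noteq> (0::int)}" and "a 0 = 0" and "finite {k. b k \<noteq> (0::int)}" and "b 0 = 0"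
    and "(\<Sum>k | a k \<noteq> 0. of_int (a k) * q_int k) = (\<Sum>k | b k \<noteq> 0. of_int (b k) * q_int k)"
  shows "a = b"
proof
  fix k
  show "a k = b k"
    using q_int_combination_nth[OF assms(1,2), of "int k"] q_int_combination_nth[OF assms(3,4), of "int k"]
    by (simp add: assms(5))
qed

section \<open>The plethysm as a generating function of tableaux, and its expansion\<close>

lemma prod_list_q_power_int:
  "prod_list (map (\<lambda>i. q powi f i) ts) = q powi (\<Sum>t\<leftarrow>ts. f t)"
proof (induction ts)
  case (Cons t ts)
  have "q powi (f t + (\<Sum>t\<leftarrow>ts. f t)) = q powi f t * q powi (\<Sum>t\<leftarrow>ts. f t)"
    by (rule power_int_add) simp
  then show ?case using Cons by (simp only: list.map prod_list.Cons sum_list.Cons)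
qed simp

lemma schur_q_powers:
  "schur \<mu> (map (\<lambda>j. q powi f j) [0..<n]) =
     (\<Sum>T\<in>bounded_tableaux \<mu> n. q powi (\<Sum>t\<leftarrow>concat T. f t))"
proof -
  have "map ((!) (map (\<lambda>j. q powi f j) [0..<n])) (concat T) = map (\<lambda>j. q powi f j) (concat T)"
    if "T \<in> bounded_tableaux \<mu> n" for T
    using that by (intro map_cong refl) (auto simp: bounded_tableaux_def)
  then show ?thesis
    unfolding schur_eq_sum by (intro sum.cong) (simp_all only: prod_list_q_power_int length_map length_upt diff_zero)
qed

text \<open>The coefficients, a priori rational, are cardinalities; this is the source of the
  integrality of the plethysm coefficients.\<close>

lemma schur_plethysm_nth:
  "schur_plethysm \<mu> h $$ k =
     of_nat (card {T \<in> bounded_tableaux \<mu> (Suc h). k = (\<Sum>t\<leftarrow>concat T. 2 * int t - int h)})"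
  unfolding schur_plethysm_def schur_q_powers fls_nth_sum q_power_int_nth
    sum.inter_filter[OF finite_bounded_tableaux, symmetric]
  by (simp only: of_nat_eq_id of_nat_sum card_eq_sum of_nat_1)

text \<open>Reversing the list of arguments negates all exponents and, by \<open>schur_rev\<close>,
  leaves the value unchanged.\<close>

lemma schur_plethysm_symmetric:
  assumes "sorted_wrt (\<ge>) \<mu>"
  shows "schur_plethysm \<mu> h $$ (- k) = schur_plethysm \<mu> h $$ k"
proof -
  have rev: "rev (map (\<lambda>j. q powi (2 * int j - int h)) [0..<Suc h]) =
    map (\<lambda>j. q powi (- (2 * int j - int h))) [0..<Suc h]"
    by (rule nth_equalityI) (auto simp: rev_nth of_nat_diff algebra_simps simp del: upt_Suc)
  have "schur_plethysm \<mu> h =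
    (\<Sum>T\<in>bounded_tableaux \<mu> (Suc h). q powi (\<Sum>t\<leftarrow>concat T. - (2 * int t - int h)))"
    unfolding schur_plethysm_def
    by (subst schur_rev[OF assms, symmetric]) (simp only: rev schur_q_powers)
  then have "schur_plethysm \<mu> h $$ k =
    (\<Sum>T\<in>bounded_tableaux \<mu> (Suc h). if k = - (\<Sum>t\<leftarrow>concat T. 2 * int t - int h) then 1 else 0)"
    by (simp only: fls_nth_sum q_power_int_nth uminus_sum_list_map o_def)
  also have "\<dots> = (\<Sum>T\<in>bounded_tableaux \<mu> (Suc h). if - k = (\<Sum>t\<leftarrow>concat T. 2 * int t - int h) then 1 else 0)"
    by (intro sum.cong refl if_cong) auto
  also have "\<dots> = schur_plethysm \<mu> h $$ (- k)"
    unfolding schur_plethysm_def schur_q_powers fls_nth_sum q_power_int_nth ..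
  finally show ?thesis ..
qed

text \<open>For symmetric \<open>S\<close> the product \<open>(q - q powi (-1)) * S\<close> is
  antisymmetric, hence a combination of the numerators of quantum integers; cancelling the factor
  gives existence.\<close>

lemma plethysm_coeff:
  assumes "sorted_wrt (\<ge>) \<mu>"
  shows "finite {k. plethysm_coeff \<mu> h k \<noteq> 0}" and "plethysm_coeff \<mu> h 0 = 0"
    and "schur_plethysm \<mu> h = (\<Sum>k | plethysm_coeff \<mu> h k \<noteq> 0. of_int (plethysm_coeff \<mu> h k) * q_int k)"
proof -
  let ?S = "schur_plethysm \<mu> h" and ?B = "bounded_tableaux \<mu> (Suc h)"
  let ?e = "\<lambda>T. \<Sum>t\<leftarrow>concat T. 2 * int t - int h"
  define s where "s k = int (card {T \<in> ?B. k = ?e T})" for k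
  have S: "?S $$ k = of_int (s k)" for k
    unfolding schur_plethysm_nth s_def by simp
  have sym: "s (- k) = s k" for k
    using schur_plethysm_symmetric[OF assms, of h k] unfolding S by simp
  \<comment> \<open>This is the coefficient of \<open>q powi int k\<close> in
    \<open>(q - q powi (-1)) * S\<close>; the symmetry of \<open>s\<close> gives the negative
    powers.\<close>
  define a where "a k = s (int k - 1) - s (int k + 1)" for k
  have "{k. a k \<noteq> 0} \<subseteq> (\<lambda>T. nat (?e T + 1)) ` ?B \<union> (\<lambda>T. nat (?e T - 1)) ` ?B"
  proof
    fix k assume "k \<in> {k. a k \<noteq> 0}"
    then have "s (int k - 1) \<noteq> 0 \<or> s (int k + 1) \<noteq> 0" by (auto simp: a_def)
    moreover have "\<exists>T\<in>?B. ?e T = j" if "s j \<noteq> 0" for j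
    proof (rule ccontr)
      assume "\<not> (\<exists>T\<in>?B. ?e T = j)"
      then have none: "{T \<in> ?B. j = ?e T} = {}" by blast
      show False using that unfolding s_def none by simp
    qed
    ultimately obtain T where "T \<in> ?B" "?e T = int k - 1 \<or> ?e T = int k + 1" by blast
    then have "k = nat (?e T + 1) \<or> k = nat (?e T - 1)" by auto
    then show "k \<in> (\<lambda>T. nat (?e T + 1)) ` ?B \<union> (\<lambda>T. nat (?e T - 1)) ` ?B"
      using \<open>T \<in> ?B\<close> by blast
  qed
  then have fin: "finite {k. a k \<noteq> 0}"
    by (rule finite_subset) (simp add: finite_bounded_tableaux)
  have zero: "a 0 = 0" using sym[of 1] by (simp add: a_def)
  have "(q - q powi (-1)) * ?S = (q - q powi (-1)) * (\<Sum>k | a k \<noteq> 0. of_int (a k) * q_int k)"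
  proof (rule fls_eqI)
    fix n
    have "s (n - 1) - s (n + 1) = (if n \<ge> 0 then a (nat n) else - a (nat (- n)))"
      using sym[of "n - 1"] sym[of "- n - 1"] by (simp add: a_def algebra_simps)
    then show "((q - q powi (-1)) * ?S) $$ n =
        ((q - q powi (-1)) * (\<Sum>k | a k \<noteq> 0. of_int (a k) * q_int k)) $$ n"
      unfolding q_int_combination_nth[OF fin zero] unfolding q_diff_times_nth S
      by (simp only: flip: of_int_diff)
  qed
  then have exp: "?S = (\<Sum>k | a k \<noteq> 0. of_int (a k) * q_int k)"
    using q_diff_nonzero mult_left_cancel by blast
  have "plethysm_coeff \<mu> h = a"
    unfolding plethysm_coeff_def
  proof (rule the_equality)
    show "finite {k. a k \<noteq> 0} \<and> a 0 = 0 \<and> ?S = (\<Sum>k | a k \<noteq> 0. of_int (a k) * q_int k)"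
      using fin zero exp by blast
  next
    fix b assume "finite {k. b k \<noteq> 0} \<and> b 0 = 0 \<and> ?S = (\<Sum>k | b k \<noteq> 0. of_int (b k) * q_int k)"
    then show "b = a" using fin zero exp q_int_expansion_unique[of b a] by metis
  qed
  then show "finite {k. plethysm_coeff \<mu> h k \<noteq> 0}" "plethysm_coeff \<mu> h 0 = 0"
    "?S = (\<Sum>k | plethysm_coeff \<mu> h k \<noteq> 0. of_int (plethysm_coeff \<mu> h k) * q_int k)"
    using fin zero exp by simp_all
qed

text \<open>The regular part keeps the coefficients at nonnegative powers, which are the plethysm
  coefficients, and discards their negated mirror images.\<close>

lemma plethysm_series_nth:
  assumes "sorted_wrt (\<ge>) \<mu>"
  shows "fps_nth (plethysm_series \<mu>) h =
    fps_to_fls (fls_regpart ((q - q powi (-1)) * schur_plethysm \<mu> h))"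
proof (rule fls_eqI)
  fix n
  let ?a = "plethysm_coeff \<mu> h"
  note a = plethysm_coeff[OF assms, of h]
  \<comment> \<open>The coefficient at index zero vanishes, so restricting to
    \<open>k \<ge> 1\<close> loses nothing.\<close>
  have "{k. k \<ge> 1 \<and> ?a k \<noteq> 0} = {k. ?a k \<noteq> 0}"
    using a(2) by (auto simp: Suc_le_eq intro: gr0I)
  then have "fps_nth (plethysm_series \<mu>) h $$ n =
    (\<Sum>k | ?a k \<noteq> 0. of_int (?a k) * (if n = int k then 1 else 0))"
    by (simp only: plethysm_series_def fps_nth_Abs_fps fls_nth_sum fls_mult_of_int_nth q_power_int_nth)
  also have "\<dots> = (\<Sum>k | ?a k \<noteq> 0. (if k = nat n then if n \<ge> 0 then of_int (?a (nat n)) else 0 else 0))"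
    by (intro sum.cong refl) auto
  also have "\<dots> = (if n \<ge> 0 then of_int (?a (nat n)) else 0)"
    using a(1) by (simp add: sum.delta')
  also have "\<dots> = (if n \<ge> 0 then ((q - q powi (-1)) * schur_plethysm \<mu> h) $$ n else 0)"
    using q_int_combination_nth[OF a(1,2), of n] unfolding a(3)[symmetric] by simp
  also have "\<dots> = fps_to_fls (fls_regpart ((q - q powi (-1)) * schur_plethysm \<mu> h)) $$ n"
    by simp
  finally show "fps_nth (plethysm_series \<mu>) h $$ n =
    fps_to_fls (fls_regpart ((q - q powi (-1)) * schur_plethysm \<mu> h)) $$ n" .
qed

section \<open>Lattice points of dilated chambers\<close>

lemma dilate_chamber_iff:
  "map real_of_int v \<in> dilate h (chamber Q) \<longleftrightarrow>
     length v = length (concat Q) \<and> set v \<subseteq> {0..int h} \<and> recording_tableau v = Q"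
proof -
  have rec: "recording_tableau (map real_of_int v) = recording_tableau v"
    by (rule recording_tableau_map) (simp add: strict_mono_def)
  show ?thesis
  proof (cases "h = 0")
    case True
    then show ?thesis by (auto simp: dilate_def chamber_def rec image_subset_iff)
  next
    case False
    \<comment> \<open>Scaling by \<open>h\<close> or \<open>1 / h\<close> is strictly increasing, so
      dilation moves only the bounds of the cube and keeps the recording tableau.\<close>
    have scale: "recording_tableau (map (\<lambda>x. c * x) u) = recording_tableau u" if "c > 0"
      for c :: real and u
      by (rule recording_tableau_map) (use that in \<open>simp add: strict_mono_def\<close>)
    show ?thesis
    proof
      assume "map real_of_int v \<in> dilate h (chamber Q)"
      then obtain u where u: "map real_of_int v = map (\<lambda>x. real h * x) u" "u \<in> chamber Q"
        using False by (auto simp: dilate_def)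
      have "length v = length u" using u(1) by (metis length_map)
      moreover have "set v \<subseteq> {0..int h}"
      proof
        fix y assume "y \<in> set v"
        then have "real_of_int y \<in> set (map (\<lambda>x. real h * x) u)" by (simp flip: u(1))
        then obtain x where "x \<in> set u" "real_of_int y = real h * x" by auto
        moreover have "0 \<le> x" "x \<le> 1" using u(2) \<open>x \<in> set u\<close> by (auto simp: chamber_def)
        ultimately have "0 \<le> real_of_int y" "real_of_int y \<le> real h"
          by (auto intro: mult_left_le)
        then show "y \<in> {0..int h}" by simp
      qed
      moreover have "recording_tableau v = Q"
        using rec scale[of "real h" u] u False by (simp add: chamber_def)
      ultimately show "length v = length (concat Q) \<and> set v \<subseteq> {0..int h} \<and> recording_tableau v = Q"
        using u(2) by (simp add: chamber_def)
    next
      assume v: "length v = length (concat Q) \<and> set v \<subseteq> {0..int h} \<and> recording_tableau v = Q"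
      define u where "u = map (\<lambda>x. (1 / real h) * x) (map real_of_int v)"
      have "recording_tableau u = recording_tableau (map real_of_int v)"
        unfolding u_def by (rule scale) (use False in simp)
      then have "recording_tableau u = Q" using rec v by simp
      moreover have "set u \<subseteq> {0..1}"
        using v False by (auto simp: u_def subset_iff)
      ultimately have "u \<in> chamber Q" using v by (simp add: chamber_def u_def)
      moreover have "map real_of_int v = map (\<lambda>x. real h * x) u"
        using False by (simp add: u_def o_def)
      ultimately show "map real_of_int v \<in> dilate h (chamber Q)"
        using False by (auto simp: dilate_def)
    qed
  qed
qed

text \<open>With \<open>Q\<close> fixed, injectivity and surjectivity of \<open>schensted\<close>
  concern the insertion tableau alone. Equal content means that a word and its tableau use the same
  alphabet.\<close>

lemma bij_betw_insertion_tableau: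
  assumes part: "partition_of \<mu> w" and Q: "standard_tableau \<mu> Q"
  shows "bij_betw (\<lambda>u. fst (schensted u))
    {u. length u = w \<and> set u \<subseteq> {..<n} \<and> recording_tableau u = Q} (bounded_tableaux \<mu> n)"
proof -
  have \<mu>: "sorted_wrt (\<ge>) \<mu>" "\<forall>p\<in>set \<mu>. p > 0" "sum_list \<mu> = w"
    using part by (auto simp: partition_of_def)
  have ss: "semistandard_tableau \<mu> T \<longleftrightarrow> ssyt T \<and> map length T = \<mu>" for T
    by (rule semistandard_iff_ssyt[OF \<mu>(1,2)])
  have Q': "ssyt Q" "map length Q = \<mu>" "distinct (concat Q)" "set (concat Q) = {1..w}"
    using Q \<mu>(3) unfolding standard_tableau_def ss by auto
  show ?thesis
  proof (rule bij_betwI')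
    fix u u' assume "u \<in> {u. length u = w \<and> set u \<subseteq> {..<n} \<and> recording_tableau u = Q}"
      "u' \<in> {u. length u = w \<and> set u \<subseteq> {..<n} \<and> recording_tableau u = Q}"
    then show "(fst (schensted u) = fst (schensted u')) = (u = u')"
      using schensted_inject[of u u'] by (auto simp: recording_tableau_def prod_eq_iff)
  next
    fix u assume "u \<in> {u. length u = w \<and> set u \<subseteq> {..<n} \<and> recording_tableau u = Q}"
    moreover have "set (concat (fst (schensted u))) = set u"
      using schensted_invariants[of u] by (metis set_mset_mset)
    ultimately show "fst (schensted u) \<in> bounded_tableaux \<mu> n"
      using schensted_invariants[of u] Q'(2) ss[of "fst (schensted u)"]
      by (simp add: bounded_tableaux_def recording_tableau_def del: set_concat)
  next
    fix T assume T: "T \<in> bounded_tableaux \<mu> n"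
    then obtain u where u: "length u = w" "schensted u = (T, Q)"
      using schensted_surj[OF Q'(1,3,4), of T] Q'(2) by (auto simp: bounded_tableaux_def ss)
    have "set (concat T) = set u" using schensted_invariants[of u] u by (metis fst_conv set_mset_mset)
    then have "set u \<subseteq> {..<n}" using T by (simp add: bounded_tableaux_def del: set_concat)
    then show "\<exists>u\<in>{u. length u = w \<and> set u \<subseteq> {..<n} \<and> recording_tableau u = Q}. T = fst (schensted u)"
      using u by (intro bexI[of _ u]) (auto simp: recording_tableau_def)
  qed
qed

text \<open>The exponent is a sum over the letters of a word, and insertion only rearranges these
  letters into cells, so each word has the weight of its tableau.\<close>

lemma quantum_ehrhart_chamber_nth:
  assumes part: "partition_of \<mu> w" and Q: "standard_tableau \<mu> Q"
  shows "fps_nth (quantum_ehrhart w (chamber Q)) h = schur_plethysm \<mu> h"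
proof -
  let ?W = "{u. length u = w \<and> set u \<subseteq> {..<Suc h} \<and> recording_tableau u = Q}"
  have len: "length (concat Q) = w"
    using part Q length_concat_semistandard by (auto simp: partition_of_def standard_tableau_def)
  have int_rec: "recording_tableau (map int u) = recording_tableau u" for u
    by (rule recording_tableau_map) (simp add: strict_mono_def)
  have "fps_nth (quantum_ehrhart w (chamber Q)) h =
    (\<Sum>v | length v = w \<and> set v \<subseteq> {0..int h} \<and> recording_tableau v = Q.
       q powi (2 * sum_list v - int w * int h))"
    by (simp add: quantum_ehrhart_def dilate_chamber_iff len)
  \<comment> \<open>Points with coordinates in \<open>{0..int h}\<close> become words over the
    \<open>Suc h\<close> natural letters that fill tableaux; the shift by \<open>- h\<close> per
    letter totals \<open>- w * h\<close>.\<close>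
  also have "\<dots> = (\<Sum>u\<in>?W. q powi (\<Sum>t\<leftarrow>u. 2 * int t - int h))"
  proof (rule sum.reindex_bij_witness[where i = "map int" and j = "map nat"], goal_cases)
    case (1 v)
    then show ?case by (auto simp: o_def intro!: map_idI)
  next
    case (2 v)
    then have "map int (map nat v) = v" by (auto simp: o_def intro!: map_idI)
    then have "recording_tableau (map nat v) = Q" using 2 int_rec[of "map nat v"] by simp
    then show ?case using 2 by (auto simp: subset_iff)
  next
    case (3 u)
    then show ?case by (auto simp: o_def)
  next
    case (4 u)
    then show ?case by (auto simp: int_rec)
  next
    case (5 v)
    then have "map int (map nat v) = v" by (auto simp: o_def intro!: map_idI)
    then have "(\<Sum>t\<leftarrow>map nat v. 2 * int t - int h) = (\<Sum>t\<leftarrow>v. 2 * t - int h)"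
      by (metis (mono_tags, lifting) map_eq_conv map_map o_def)
    also have "\<dots> = 2 * sum_list v - int w * int h"
      using 5 by (simp add: sum_list_subtractf sum_list_const_mult sum_list_triv)
    finally show ?case by simp
  qed
  also have "\<dots> = (\<Sum>u\<in>?W. q powi (\<Sum>t\<leftarrow>concat (fst (schensted u)). 2 * int t - int h))"
  proof (rule sum.cong[OF refl])
    fix u :: "nat list"
    have "mset (map f (concat (fst (schensted u)))) = mset (map f u)" for f :: "nat \<Rightarrow> int"
      using schensted_invariants[of u] by (metis mset_map)
    then show "q powi (\<Sum>t\<leftarrow>u. 2 * int t - int h) =
        q powi (\<Sum>t\<leftarrow>concat (fst (schensted u)). 2 * int t - int h)"
      by (metis sum_mset_sum_list)
  qed
  also have "\<dots> = (\<Sum>T\<in>bounded_tableaux \<mu> (Suc h). q powi (\<Sum>t\<leftarrow>concat T. 2 * int t - int h))"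
    by (rule sum.reindex_bij_betw[OF bij_betw_insertion_tableau[OF assms]])
  also have "\<dots> = schur_plethysm \<mu> h" unfolding schur_plethysm_def schur_q_powers ..
  finally show ?thesis .
qed

theorem theorem2p24:
  fixes \<mu> :: "nat list" and w :: nat and Q :: "nat list list"
  assumes "w \<ge> 1"
    and "partition_of \<mu> w"
    and "standard_tableau \<mu> Q"
  shows "plethysm_series \<mu> =
    positive_terms (fps_const (q - q powi (-1)) * quantum_ehrhart w (chamber Q))"
proof (rule fps_ext)
  fix h
  \<comment> \<open>The prefactor is constant in \<open>z\<close>, so for each \<open>h\<close> both
    sides are the regular part of the same Laurent polynomial.\<close>
  have "sorted_wrt (\<ge>) \<mu>" using assms(2) by (simp add: partition_of_def)
  then show "fps_nth (plethysm_series \<mu>) h = fps_nth (positive_terms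
      (fps_const (q - q powi (-1)) * quantum_ehrhart w (chamber Q))) h"
    unfolding positive_terms_def fps_nth_Abs_fps fps_mult_left_const_nth
    by (simp only: plethysm_series_nth quantum_ehrhart_chamber_nth[OF assms(2,3)])
qed

end
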